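(* Let $X=X(\Sigma)$ be a toric variety of dimension $n$, let $\Psi$ be a choice of complements for $\Sigma$, let $D$ and $E$ be $\mathbb{Q}$-Cartier divisors on $X$, and let $\sigma$ be a cone of $\Sigma$ of dimension $n-k$. Then $$D\cdot\bigl(E\cdot[V(\sigma)]\bigr)=E\cdot\bigl(D\cdot[V(\sigma)]\bigr).$$
   Context: Setting. $N$ is a free abelian group of rank $n$, $M=\operatorname{Hom}(N,\mathbb{Z})$, $N_{\mathbb{Q}}=\mathbb{Q}\otimes N$, $M_{\mathbb{Q}}=\mathbb{Q}\otimes M$, $\Sigma$ is a fan of strongly convex rational polyhedral cones in $N_{\mathbb{Q}}$, and $X=X(\Sigma)$ is the associated toric variety. For cones, $\tau\succ\sigma$ means $\sigma$ is a proper face of $\tau$, and $\tau\to\sigma$ means $\sigma$ is a facet of $\tau$. For $\sigma\in\Sigma$, $N_\sigma$ is the subgroup of $N$ generated by $\sigma\cap N$. Write $M(\sigma)=\sigma^\perp\subset M_{\mathbb{Q}}$, $M_\tau=M_{\mathbb{Q}}/M(\tau)$, and for $\sigma\prec\tau$, $M(\sigma)_\tau=M(\sigma)/M(\tau)$, which is dual to $\mathbb{Q}\otimes(N_\tau/N_\sigma)$; $\langle\cdot,\cdot\rangle$ denotes the duality pairings. If $\tau\to\sigma$, $n_{\tau,\sigma}$ is the generator of $N_\tau/N_\sigma\cong\mathbb{Z}$ lying in the image of $\tau$. Cycles and divisors. For $\sigma\in\Sigma$ of dimension $n-k$, $V(\sigma)$ is the associated $k$-dimensional torus-invariant subvariety;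 $Z_k(X)_{\mathbb{Q}}$ is the $\mathbb{Q}$-vector space with basis the $[V(\sigma)]$, $\dim\sigma=n-k$. An equivariant $\mathbb{Q}$-Cartier divisor $D$ on $X$ is a collection of local equations $m_\sigma\in M_\sigma$ ($\sigma\in\Sigma$) such that for $\tau\prec\sigma$ the natural map $M_\sigma\to M_\tau$ sends $m_\sigma$ to $m_\tau$. Choice of complements. $\Psi$ assigns to each $\sigma\in\Sigma$ a linear subspace $\Psi(\sigma)\subset M_{\mathbb{Q}}$ of dimension $\dim\sigma$ such that $\Psi(\sigma)\cap M(\sigma)=0$ (so $M_{\mathbb{Q}}=M(\sigma)\oplus\Psi(\sigma)$), and $\Psi(\tau)\subset\Psi(\sigma)$ whenever $\tau\prec\sigma$. Let $\pi_\sigma:M_{\mathbb{Q}}\to M(\sigma)$ be the projection along $\Psi(\sigma)$; for $\tau\succ\sigma$ it induces a map, also denoted $\pi_\sigma:M_\tau\to M(\sigma)_\tau$. Action. For $D$ with local equations $m_\tau$, $D\cdot[V(\sigma)]=\sum_{\tau\to\sigma}\langle\pi_\sigma(m_\tau),n_{\tau,\sigma}\rangle[V(\tau)]$, extended linearly to a map $D\cdot{}:Z_k(X)_{\mathbb{Q}}\to Z_{k-1}(X)_{\mathbb{Q}}$. *)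

theory Defs
  imports
    Complex_Main
    "HOL-Computational_Algebra.Group_Closure"
    "HOL-Library.Function_Algebras"
    "HOL-Library.Set_Algebras"
    "HOL-Library.Poly_Mapping"
begin

text \<open>
  For subgroups \<open>B \<subseteq> A\<close> of an ambient group, \<open>cosets A B\<close> is the quotient \<open>A / B\<close>;
  its elements are the sets \<open>a +o B\<close>.
\<close>

definition cosets :: "'a::ab_group_add set \<Rightarrow> 'a set \<Rightarrow> 'a set set" where
  "cosets A B = (\<lambda>a. a +o B) ` A"

text \<open>
  A free abelian group \<open>N\<close> of rank \<open>n\<close> sits in the rational vector space \<open>N\<^sub>\<rat> = \<rat> \<otimes> N\<close> as the
  subgroup generated by a basis. So we fix a finite-dimensional rational vector space (the whole
  type \<open>'v\<close>, playing the role of \<open>N\<^sub>\<rat>\<close>) with a basis \<open>Basis\<close>, and take for \<open>N\<close> the subgroup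
  generated by \<open>Basis\<close>. Then \<open>n = card Basis\<close>, and \<open>n = 0\<close> is allowed.
\<close>

locale toric_lattice = finite_dimensional_vector_space scale Basis
  for scale :: "rat \<Rightarrow> 'v::ab_group_add \<Rightarrow> 'v"  (infixr \<open>*s\<close> 75)
  and Basis :: "'v set"
begin

definition N :: "'v set" where
  "N = group_closure Basis"

text \<open>
  \<open>M\<^sub>\<rat> = \<rat> \<otimes> Hom(N, \<int>)\<close> is realized as the space of linear functionals on \<open>N\<^sub>\<rat>\<close>.
\<close>

definition MQ :: "('v \<Rightarrow> rat) set" where
  "MQ = {m. Vector_Spaces.linear scale (*) m}"

definition scaleM :: "rat \<Rightarrow> ('v \<Rightarrow> rat) \<Rightarrow> ('v \<Rightarrow> rat)" where
  "scaleM c m = (\<lambda>x. c * m x)"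


subsection \<open>Cones and fans\<close>

definition cone_generated :: "'v set \<Rightarrow> 'v set" where
  "cone_generated S = {\<Sum>v\<in>S. a v *s v | a. \<forall>v\<in>S. 0 \<le> a v}"

definition rational_polyhedral_cone :: "'v set \<Rightarrow> bool" where
  "rational_polyhedral_cone \<sigma> \<longleftrightarrow> (\<exists>S. finite S \<and> S \<subseteq> N \<and> \<sigma> = cone_generated S)"

definition strongly_convex :: "'v set \<Rightarrow> bool" where
  "strongly_convex \<sigma> \<longleftrightarrow> \<sigma> \<inter> uminus ` \<sigma> = {0}"

text \<open>
  A face is cut out by a functional that is nonnegative on the cone; the functional \<open>0\<close> shows
  that a cone is a face of itself.
\<close>

definition face :: "'v set \<Rightarrow> 'v set \<Rightarrow> bool" where
  "face \<tau> \<sigma> \<longleftrightarrow> (\<exists>m\<in>MQ. (\<forall>x\<in>\<sigma>. 0 \<le> m x) \<and> \<tau> = {x\<in>\<sigma>. m x = 0})"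

definition proper_face :: "'v set \<Rightarrow> 'v set \<Rightarrow> bool" where
  "proper_face \<tau> \<sigma> \<longleftrightarrow> face \<tau> \<sigma> \<and> \<tau> \<noteq> \<sigma>"

text \<open>
  The constant \<open>dim\<close> of the library is the dimension of the linear span.
\<close>

definition facet :: "'v set \<Rightarrow> 'v set \<Rightarrow> bool" where
  "facet \<tau> \<sigma> \<longleftrightarrow> face \<tau> \<sigma> \<and> dim \<sigma> = dim \<tau> + 1"

definition fan :: "'v set set \<Rightarrow> bool" where
  "fan \<Sigma> \<longleftrightarrow> finite \<Sigma>
     \<and> (\<forall>\<sigma>\<in>\<Sigma>. rational_polyhedral_cone \<sigma> \<and> strongly_convex \<sigma>)
     \<and> (\<forall>\<sigma>\<in>\<Sigma>. \<forall>\<tau>. face \<tau> \<sigma> \<longrightarrow> \<tau> \<in> \<Sigma>)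
     \<and> (\<forall>\<sigma>\<in>\<Sigma>. \<forall>\<tau>\<in>\<Sigma>. face (\<sigma> \<inter> \<tau>) \<sigma> \<and> face (\<sigma> \<inter> \<tau>) \<tau>)"


subsection \<open>Lattices attached to cones, and their duals\<close>

definition N_cone :: "'v set \<Rightarrow> 'v set" where
  "N_cone \<sigma> = group_closure (\<sigma> \<inter> N)"

text \<open>\<open>perp \<sigma>\<close> is \<open>M(\<sigma>)\<close>, and \<open>M_cone \<sigma>\<close> is \<open>M\<^sub>\<sigma>\<close>.\<close>

definition perp :: "'v set \<Rightarrow> ('v \<Rightarrow> rat) set" where
  "perp \<sigma> = {m\<in>MQ. \<forall>x\<in>\<sigma>. m x = 0}"

definition M_cone :: "'v set \<Rightarrow> ('v \<Rightarrow> rat) set set" where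
  "M_cone \<sigma> = cosets MQ (perp \<sigma>)"

text \<open>
  The pairing of \<open>c \<in> M(\<sigma>) / M(\<tau>)\<close> with \<open>\<nu> \<in> N\<^sub>\<tau> / N\<^sub>\<sigma>\<close> is the common value of
  \<open>f x\<close> over all representatives \<open>f\<close> of \<open>c\<close> and \<open>x\<close> of \<open>\<nu>\<close>.
\<close>

definition pairing :: "('v \<Rightarrow> rat) set \<Rightarrow> 'v set \<Rightarrow> rat" where
  "pairing c \<nu> = (THE q. \<forall>f\<in>c. \<forall>x\<in>\<nu>. f x = q)"

text \<open>
  For a facet \<open>\<sigma>\<close> of \<open>\<tau>\<close>, \<open>normal_gen \<tau> \<sigma>\<close> is \<open>n\<^bsub>\<tau>,\<sigma>\<^esub>\<close>: the coset that generates the infinite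
  cyclic group \<open>N\<^sub>\<tau> / N\<^sub>\<sigma>\<close> and is the class of a lattice point of \<open>\<tau>\<close>.
\<close>

definition normal_gen :: "'v set \<Rightarrow> 'v set \<Rightarrow> 'v set" where
  "normal_gen \<tau> \<sigma> =
     (THE \<nu>. \<exists>x \<in> \<tau> \<inter> N. \<nu> = x +o N_cone \<sigma> \<and>
        cosets (N_cone \<tau>) (N_cone \<sigma>) = {(of_int k *s x) +o N_cone \<sigma> | k :: int. True})"


subsection \<open>Divisors, cycles and complements\<close>

text \<open>
  A divisor is its family of local equations; only the values on \<open>\<Sigma>\<close> matter. The natural map
  \<open>M\<^sub>\<sigma> \<rightarrow> M\<^sub>\<tau>\<close> for \<open>M(\<sigma>) \<subseteq> M(\<tau>)\<close> sends the coset \<open>c\<close> to the coset \<open>c + M(\<tau>)\<close>.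
\<close>

definition Q_Cartier_divisor :: "'v set set \<Rightarrow> ('v set \<Rightarrow> ('v \<Rightarrow> rat) set) \<Rightarrow> bool" where
  "Q_Cartier_divisor \<Sigma> D \<longleftrightarrow>
     (\<forall>\<sigma>\<in>\<Sigma>. D \<sigma> \<in> M_cone \<sigma>) \<and>
     (\<forall>\<sigma>\<in>\<Sigma>. \<forall>\<tau>\<in>\<Sigma>. proper_face \<tau> \<sigma> \<longrightarrow> D \<sigma> + perp \<tau> = D \<tau>)"

definition complements :: "'v set set \<Rightarrow> ('v set \<Rightarrow> ('v \<Rightarrow> rat) set) \<Rightarrow> bool" where
  "complements \<Sigma> \<Psi> \<longleftrightarrow>
     (\<forall>\<sigma>\<in>\<Sigma>. \<Psi> \<sigma> \<subseteq> MQ \<and> module.subspace scaleM (\<Psi> \<sigma>)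
        \<and> vector_space.dim scaleM (\<Psi> \<sigma>) = dim \<sigma> \<and> \<Psi> \<sigma> \<inter> perp \<sigma> = {0}) \<and>
     (\<forall>\<sigma>\<in>\<Sigma>. \<forall>\<tau>\<in>\<Sigma>. proper_face \<tau> \<sigma> \<longrightarrow> \<Psi> \<tau> \<subseteq> \<Psi> \<sigma>)"

definition proj :: "('v set \<Rightarrow> ('v \<Rightarrow> rat) set) \<Rightarrow> 'v set \<Rightarrow> ('v \<Rightarrow> rat) \<Rightarrow> ('v \<Rightarrow> rat)" where
  "proj \<Psi> \<sigma> m = (THE u. u \<in> perp \<sigma> \<and> m - u \<in> \<Psi> \<sigma>)"

text \<open>
  A cycle is a finitely supported rational combination of cones, the cone \<open>\<sigma>\<close> standing for the
  subvariety \<open>V(\<sigma>)\<close>. The map induced by \<open>\<pi>\<^sub>\<sigma>\<close> on \<open>M\<^sub>\<tau>\<close> is the image of cosets under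
  \<open>proj \<Psi> \<sigma>\<close>: as \<open>M(\<tau>) \<subseteq> M(\<sigma>)\<close> is fixed pointwise by \<open>\<pi>\<^sub>\<sigma>\<close>, the image of \<open>m + M(\<tau>)\<close> is
  the coset \<open>\<pi>\<^sub>\<sigma>(m) + M(\<tau>)\<close>.
\<close>

definition V :: "'v set \<Rightarrow> ('v set \<Rightarrow>\<^sub>0 rat)" where
  "V \<sigma> = Poly_Mapping.single \<sigma> 1"

definition scaleZ :: "rat \<Rightarrow> ('v set \<Rightarrow>\<^sub>0 rat) \<Rightarrow> ('v set \<Rightarrow>\<^sub>0 rat)" where
  "scaleZ c z = Poly_Mapping.map ((*) c) z"

definition cycles :: "'v set set \<Rightarrow> nat \<Rightarrow> ('v set \<Rightarrow>\<^sub>0 rat) set" where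
  "cycles \<Sigma> k = {z. Poly_Mapping.keys z \<subseteq> {\<sigma>\<in>\<Sigma>. dim \<sigma> + k = card Basis}}"

definition act_cone ::
  "'v set set \<Rightarrow> ('v set \<Rightarrow> ('v \<Rightarrow> rat) set) \<Rightarrow> ('v set \<Rightarrow> ('v \<Rightarrow> rat) set) \<Rightarrow> 'v set \<Rightarrow> ('v set \<Rightarrow>\<^sub>0 rat)"
  where
  "act_cone \<Sigma> \<Psi> D \<sigma> =
     (\<Sum>\<tau> | \<tau> \<in> \<Sigma> \<and> facet \<sigma> \<tau>. scaleZ (pairing (proj \<Psi> \<sigma> ` D \<tau>) (normal_gen \<tau> \<sigma>)) (V \<tau>))"

definition act ::
  "'v set set \<Rightarrow> ('v set \<Rightarrow> ('v \<Rightarrow> rat) set) \<Rightarrow> ('v set \<Rightarrow> ('v \<Rightarrow> rat) set)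
     \<Rightarrow> ('v set \<Rightarrow>\<^sub>0 rat) \<Rightarrow> ('v set \<Rightarrow>\<^sub>0 rat)"
  where
  "act \<Sigma> \<Psi> D z =
     (\<Sum>\<sigma>\<in>Poly_Mapping.keys z. scaleZ (Poly_Mapping.lookup z \<sigma>) (act_cone \<Sigma> \<Psi> D \<sigma>))"

lemma lookup_scaleZ [simp]: "Poly_Mapping.lookup (scaleZ c z) \<sigma> = c * Poly_Mapping.lookup z \<sigma>"
  by (simp add: scaleZ_def map.rep_eq when_def)

lemma act_V: "act \<Sigma> \<Psi> D (V \<sigma>) = act_cone \<Sigma> \<Psi> D \<sigma>"
  by (rule poly_mapping_eqI) (simp add: act_def V_def)

lemma act_cycles:
  assumes "z \<in> cycles \<Sigma> (Suc k)"
  shows "act \<Sigma> \<Psi> D z \<in> cycles \<Sigma> k"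
proof -
  have "\<tau> \<in> \<Sigma> \<and> dim \<tau> + k = card Basis" if \<tau>: "\<tau> \<in> Poly_Mapping.keys (act \<Sigma> \<Psi> D z)" for \<tau>
  proof -
    have "Poly_Mapping.lookup (act \<Sigma> \<Psi> D z) \<tau> \<noteq> 0"
      using \<tau> by (simp add: in_keys_iff)
    then obtain \<sigma> where \<sigma>: "\<sigma> \<in> Poly_Mapping.keys z"
      and "Poly_Mapping.lookup (act_cone \<Sigma> \<Psi> D \<sigma>) \<tau> \<noteq> 0"
      unfolding act_def lookup_sum lookup_scaleZ
      by (metis (no_types, lifting) mult_zero_right sum.neutral)
    then obtain \<rho> where "\<rho> \<in> \<Sigma>" "facet \<sigma> \<rho>" "Poly_Mapping.lookup (V \<rho>) \<tau> \<noteq> 0"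
      unfolding act_cone_def lookup_sum lookup_scaleZ
      by (metis (no_types, lifting) mem_Collect_eq mult_zero_right sum.neutral)
    then have "\<tau> \<in> \<Sigma>" "facet \<sigma> \<tau>"
      by (auto simp: V_def lookup_single when_def split: if_splits)
    moreover have "dim \<sigma> + Suc k = card Basis"
      using assms \<sigma> by (auto simp: cycles_def)
    ultimately show ?thesis
      by (simp add: facet_def)
  qed
  then show ?thesis
    by (auto simp: cycles_def)
qed

end

end

theory Submission
  imports Defs
begin

text \<open>
  The coefficient of \<open>[V(\<gamma>)]\<close> in \<open>D \<cdot> (E \<cdot> [V(\<sigma>)])\<close> is a sum over the cones \<open>\<tau>\<close> strictly between \<open>\<sigma>\<close>
  and \<open>\<gamma>\<close>, of which there are exactly two. Let \<open>d\<close> and \<open>e\<close> be the projections to \<open>M(\<sigma>)\<close> of the local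
  equations of \<open>D\<close> and \<open>E\<close> on \<open>\<gamma>\<close>, and let \<open>x\<close> and \<open>y\<close> be lattice points representing the normal vectors of
  \<open>\<sigma>\<close> in \<open>\<tau>\<close> and of \<open>\<tau>\<close> in \<open>\<gamma>\<close>. Antisymmetrizing the term of \<open>\<tau>\<close> in \<open>D\<close> and \<open>E\<close> eliminates \<open>\<Psi> \<tau>\<close> and leaves
  the determinant \<open>e(x) d(y) - d(x) e(y)\<close>. For each of the two \<open>\<tau>\<close> the pair \<open>(x, y)\<close> is a basis of the rank two
  lattice \<open>N\<^sub>\<gamma> / N\<^sub>\<sigma>\<close>; the two bases have opposite orientations, so the two determinants cancel.
\<close>

section \<open>Generated subgroups and their cosets\<close>

lemma group_closure_coset_eq:
  assumes "a - b \<in> group_closure S"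
  shows "a +o group_closure S = b +o group_closure S"
proof -
  have sub: "a +o group_closure S \<subseteq> b +o group_closure S" if "a - b \<in> group_closure S" for a b :: 'a
  proof
    fix x assume "x \<in> a +o group_closure S"
    then have "x - a \<in> group_closure S"
      by (rule set_plus_imp_minus)
    from group_closure_add[OF this that] show "x \<in> b +o group_closure S"
      by (intro set_minus_imp_plus) simp
  qed
  have "b - a \<in> group_closure S"
    using assms group_closure_minus_iff[of "a - b" S] by simp
  with assms sub show ?thesis by blast
qed

lemma group_closure_mono_elem:
  assumes "x \<in> group_closure S" and "\<And>s. s \<in> S \<Longrightarrow> s \<in> group_closure T"
  shows "x \<in> group_closure T"
  using assms(1) by induction (auto intro: assms(2) group_closure.intros)

lemma sum_fun_apply: "(\<Sum>i\<in>A. f i) x = (\<Sum>i\<in>A. f i x)"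
  for f :: "'a \<Rightarrow> 'b \<Rightarrow> 'c::comm_monoid_add"
  by (induction A rule: infinite_finite_induct) auto

context toric_lattice
begin

lemma vector_space_scaleM: "vector_space scaleM"
  by unfold_locales (auto simp: scaleM_def fun_eq_iff algebra_simps)

interpretation M: vector_space scaleM
  by (rule vector_space_scaleM)

lemma vector_space_pair_dual: "vector_space_pair scale ((*) :: rat \<Rightarrow> rat \<Rightarrow> rat)"
  by unfold_locales (auto simp: algebra_simps)

subsection \<open>Functionals and annihilators\<close>

lemma
  assumes "m \<in> MQ"
  shows MQ_add: "m (x + y) = m x + m y"
    and MQ_diff: "m (x - y) = m x - m y"
    and MQ_scale: "m (c *s x) = c * m x"
    and MQ_zero: "m 0 = 0"
    and MQ_sum: "m (sum f A) = (\<Sum>i\<in>A. m (f i))"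
proof -
  interpret m: Vector_Spaces.linear scale "(*) :: rat \<Rightarrow> rat \<Rightarrow> rat" m
    using assms by (simp add: MQ_def)
  show "m (x + y) = m x + m y" "m (x - y) = m x - m y" "m (c *s x) = c * m x" "m 0 = 0"
    "m (sum f A) = (\<Sum>i\<in>A. m (f i))"
    by (rule m.add m.diff m.scale m.zero m.sum)+
qed

lemma subspace_MQ: "M.subspace MQ"
  by (rule M.subspaceI)
    (simp_all add: MQ_def scaleM_def zero_fun_def plus_fun_def
      vector_space_pair_dual[THEN vector_space_pair.linear_zero]
      vector_space_pair_dual[THEN vector_space_pair.linear_compose_add]
      vector_space_pair_dual[THEN vector_space_pair.linear_compose_scale_right])

lemma subspace_perp: "M.subspace (perp A)"
  using subspace_MQ by (auto simp: perp_def M.subspace_def scaleM_def)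

lemma perp_subset_MQ: "perp A \<subseteq> MQ"
  by (auto simp: perp_def)

lemma perp_antimono: "A \<subseteq> B \<Longrightarrow> perp B \<subseteq> perp A"
  by (auto simp: perp_def)

lemma perp_eq_0: "m \<in> perp A \<Longrightarrow> x \<in> A \<Longrightarrow> m x = 0"
  by (simp add: perp_def)

lemma perp_span_eq_0:
  assumes "m \<in> perp A" "x \<in> span A"
  shows "m x = 0"
  using assms vector_space_pair.linear_eq_0_on_span[OF vector_space_pair_dual, of m A x] by (auto simp: perp_def MQ_def)

lemma perp_spanI: "m \<in> MQ \<Longrightarrow> (\<And>x. x \<in> A \<Longrightarrow> m x = 0) \<Longrightarrow> B \<subseteq> span A \<Longrightarrow> m \<in> perp B"
  using perp_span_eq_0[of m A] by (auto simp: perp_def)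

text \<open>A basis of the span of \<open>A\<close> stays independent when \<open>x\<close> is
  adjoined, so a functional can be prescribed to be 0 on that basis and 1 at
  \<open>x\<close>.\<close>

lemma perp_separates:
  assumes "x \<notin> span A"
  obtains m where "m \<in> perp A" "m x = 1"
proof -
  obtain B where B: "B \<subseteq> A" "independent B" "A \<subseteq> span B"
    using maximal_independent_subset by blast
  have "x \<notin> span B"
    using assms B(1) span_mono by blast
  with B(2) have "independent (insert x B)"
    by (rule independent_insertI[rotated])
  then obtain m where m: "Vector_Spaces.linear scale (*) m"
      "\<forall>y\<in>insert x B. m y = (if y = x then 1 else 0)"
    using vector_space_pair.linear_independent_extend[OF vector_space_pair_dual,
        of "insert x B" "\<lambda>y. if y = x then 1 else 0"] by blast
  have "m \<in> perp A"
    using m B(3) \<open>x \<notin> span B\<close> span_superset[of B] by (intro perp_spanI[of m B A]) (auto simp: MQ_def)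
  with m show thesis by (intro that[of m]) auto
qed

lemma dim_less_if_not_in_span:
  assumes "A \<subseteq> B" "x \<in> B" "x \<notin> span A"
  shows "dim A < dim B"
proof -
  have "dim (insert x A) \<le> dim B"
    using assms by (intro dim_subset) auto
  with assms(3) show ?thesis by (simp add: dim_insert)
qed

text \<open>In relative dimension one, a single vector outside the smaller span already fills up the
  dimension.\<close>

lemma span_insert_eq_span:
  assumes "A \<subseteq> B" "x \<in> B" "x \<notin> span A" "dim B = dim A + 1"
  shows "span (insert x A) = span B"
proof (rule subspace_dim_equal)
  show "span (insert x A) \<subseteq> span B"
    using assms by (intro span_mono) auto
  show "dim (span B) \<le> dim (span (insert x A))"
    using assms by (simp add: dim_insert)
qed auto

subsection \<open>Lattice points of cones\<close>

lemma group_closure_of_int_scale: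
  assumes "v \<in> group_closure S"
  shows "of_int k *s v \<in> group_closure S"
proof -
  have nat: "of_nat j *s v \<in> group_closure S" for j :: nat
    by (induction j) (auto simp: scale_left_distrib assms group_closure_add)
  show ?thesis
    by (cases k) (use nat group_closure.diff[OF zero_in_group_closure nat] in
        \<open>auto simp: scale_left_diff_distrib simp del: of_nat_Suc\<close>)
qed

lemma generators_subset_cone:
  assumes "finite S"
  shows "S \<subseteq> cone_generated S"
proof
  fix s assume "s \<in> S"
  then have "s = (\<Sum>v\<in>S. (if v = s then 1 else 0) *s v)"
    using assms by (simp add: if_distrib[of "\<lambda>c. c *s _"] cong: if_cong)
  then show "s \<in> cone_generated S"
    unfolding cone_generated_def by (intro CollectI exI[of _ "\<lambda>v. if v = s then 1 else 0"]) auto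
qed

lemma cone_add:
  assumes "x \<in> cone_generated S" "y \<in> cone_generated S"
  shows "x + y \<in> cone_generated S"
proof -
  obtain a b where "\<forall>v\<in>S. 0 \<le> a v" "x = (\<Sum>v\<in>S. a v *s v)" "\<forall>v\<in>S. 0 \<le> b v" "y = (\<Sum>v\<in>S. b v *s v)"
    using assms by (auto simp: cone_generated_def)
  then show ?thesis
    unfolding cone_generated_def
    by (intro CollectI exI[of _ "\<lambda>v. a v + b v"]) (auto simp: scale_left_distrib sum.distrib)
qed

lemma cone_scale:
  assumes "x \<in> cone_generated S" "0 \<le> c"
  shows "c *s x \<in> cone_generated S"
proof -
  obtain a where "\<forall>v\<in>S. 0 \<le> a v" "x = (\<Sum>v\<in>S. a v *s v)"
    using assms by (auto simp: cone_generated_def)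
  with assms(2) show ?thesis
    unfolding cone_generated_def
    by (intro CollectI exI[of _ "\<lambda>v. c * a v"]) (auto simp: scale_sum_right)
qed

lemma cone_subset_span: "cone_generated S \<subseteq> span S"
  by (auto simp: cone_generated_def intro!: span_sum span_scale intro: span_base)

lemma cone_nonneg:
  assumes "m \<in> MQ" "\<And>s. s \<in> S \<Longrightarrow> 0 \<le> m s" "x \<in> cone_generated S"
  shows "0 \<le> m x"
  using assms by (auto simp: cone_generated_def MQ_sum MQ_scale intro!: sum_nonneg)

text \<open>The sum of the generators is interior, so large multiples of it absorb every vector of the span.\<close>

lemma span_absorbed_by_cone:
  assumes "finite S" "w \<in> span S"
  obtains k :: nat where "w + of_nat k *s \<Sum>S \<in> cone_generated S"
proof -
  obtain r where r: "w = (\<Sum>v\<in>S. r v *s v)"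
    using assms by (auto simp: span_finite)
  obtain k :: nat where k: "(\<Sum>v\<in>S. \<bar>r v\<bar>) \<le> of_nat k"
    using real_arch_simple[where x = "_ :: rat"] by blast
  have "0 \<le> r v + of_nat k" if "v \<in> S" for v
  proof -
    have "\<bar>r v\<bar> \<le> (\<Sum>v\<in>S. \<bar>r v\<bar>)"
      using assms(1) that by (intro member_le_sum) auto
    with k show ?thesis by linarith
  qed
  moreover have "w + of_nat k *s \<Sum>S = (\<Sum>v\<in>S. (r v + of_nat k) *s v)"
    by (simp add: r scale_left_distrib sum.distrib scale_sum_right)
  ultimately show thesis
    by (intro that[of k]) (auto simp: cone_generated_def)
qed

lemma sum_generators_in_N: "finite S \<Longrightarrow> S \<subseteq> N \<Longrightarrow> \<Sum>S \<in> N"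
  by (induction S rule: finite_induct) (auto simp: N_def group_closure_add)

lemma sum_generators_in_cone: "finite S \<Longrightarrow> \<Sum>S \<in> cone_generated S"
  unfolding cone_generated_def by (intro CollectI exI[of _ "\<lambda>_. 1"]) auto

lemma N_cone_subset_N: "N_cone A \<subseteq> N"
  unfolding N_cone_def N_def by (auto elim!: group_closure_mono_elem)

lemma N_cone_subset_span: "N_cone A \<subseteq> span A"
proof
  fix x assume "x \<in> N_cone A"
  then show "x \<in> span A"
    unfolding N_cone_def by induction (auto intro: span_base span_diff span_zero)
qed

lemma N_cone_base: "x \<in> A \<Longrightarrow> x \<in> N \<Longrightarrow> x \<in> N_cone A"
  by (simp add: N_cone_def group_closure.base)

text \<open>Saturation: a lattice point \<open>w\<close> of the span moves into the cone when a
  large multiple of the sum of the generators is added. That multiple and the shifted point are both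
  lattice points of the cone, and \<open>w\<close> is their difference.\<close>

lemma N_cone_eq:
  assumes "rational_polyhedral_cone A"
  shows "N_cone A = N \<inter> span A"
proof
  show "N_cone A \<subseteq> N \<inter> span A"
    using N_cone_subset_N N_cone_subset_span by blast
  obtain S where S: "finite S" "S \<subseteq> N" "A = cone_generated S"
    using assms by (auto simp: rational_polyhedral_cone_def)
  show "N \<inter> span A \<subseteq> N_cone A"
  proof
    fix w assume w: "w \<in> N \<inter> span A"
    then have "w \<in> span S"
      using cone_subset_span[of S] S(3) span_mono[of A "span S"] by (auto simp: span_span)
    then obtain k :: nat where k: "w + of_nat k *s \<Sum>S \<in> A"
      using span_absorbed_by_cone[OF S(1)] S(3) by metis
    let ?p = "of_nat k *s \<Sum>S"
    have p: "?p \<in> N"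
      using group_closure_of_int_scale[of "\<Sum>S" Basis "int k"] sum_generators_in_N[OF S(1,2)]
      by (simp add: N_def)
    have "?p \<in> A"
      using S sum_generators_in_cone by (auto intro: cone_scale)
    moreover have "w + ?p \<in> N"
      using w p by (auto simp: N_def group_closure_add)
    ultimately have "?p \<in> N_cone A" "w + ?p \<in> N_cone A"
      using p k by (auto intro: N_cone_base)
    then have "(w + ?p) - ?p \<in> N_cone A"
      unfolding N_cone_def by (rule group_closure.diff[rotated])
    then show "w \<in> N_cone A" by simp
  qed
qed

text \<open>\<open>N\<close> has finitely many generators, so the product of the denominators at the
  generators works. It makes the values of \<open>m\<close> on \<open>N\<close> discrete, so that a
  least positive value can be chosen.\<close>

lemma MQ_common_denominator:
  assumes "m \<in> MQ"
  obtains q :: nat where "q > 0" "\<And>v. v \<in> N \<Longrightarrow> of_nat q * m v \<in> \<int>"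
proof -
  have "\<exists>q>0. \<forall>b\<in>B. of_nat q * m b \<in> \<int>" if "finite B" for B
    using that
  proof (induction B rule: finite_induct)
    case empty
    show ?case by auto
  next
    case (insert b B)
    then obtain q where q: "q > 0" "\<forall>b\<in>B. of_nat q * m b \<in> \<int>" by blast
    obtain x y where xy: "quotient_of (m b) = (x, y)" by (cases "quotient_of (m b)")
    then have y: "y > 0" "m b = of_int x / of_int y"
      by (auto intro: quotient_of_denom_pos quotient_of_div)
    have "of_nat (q * nat y) * m c \<in> \<int>" if "c \<in> insert b B" for c
    proof (cases "c = b")
      case True
      then have "of_nat (q * nat y) * m c = of_int (int q * x)"
        using y by simp
      then show ?thesis by (metis Ints_of_int)
    next
      case False
      with that q have "of_nat q * m c \<in> \<int>" by simp
      from Ints_mult[OF Ints_of_int[of y] this] have "of_int y * (of_nat q * m c) \<in> \<int>" .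
      moreover have "of_nat (q * nat y) * m c = of_int y * (of_nat q * m c)"
        using y(1) by simp
      ultimately show ?thesis by (simp only:)
    qed
    then show ?case using q(1) y(1) by (intro exI[of _ "q * nat y"]) auto
  qed
  then obtain q where q: "q > 0" "\<forall>b\<in>Basis. of_nat q * m b \<in> \<int>"
    using finite_Basis by blast
  have "of_nat q * m v \<in> \<int>" if "v \<in> N" for v
    using that unfolding N_def
  proof induction
    case (base s)
    then show ?case using q assms by (auto simp: MQ_zero)
  next
    case (diff s t)
    then show ?case using assms by (auto simp: MQ_diff right_diff_distrib)
  qed
  with q(1) that show thesis by blast
qed


subsection \<open>The normal vector of a facet\<close>

text \<open>The third fact is the intersection axiom for nested cones, whose intersection is the
  smaller cone.\<close>

lemma fanD:
  assumes "fan \<Sigma>"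
  shows "\<sigma> \<in> \<Sigma> \<Longrightarrow> rational_polyhedral_cone \<sigma>"
    and "\<sigma> \<in> \<Sigma> \<Longrightarrow> face \<tau> \<sigma> \<Longrightarrow> \<tau> \<in> \<Sigma>"
    and "\<sigma> \<in> \<Sigma> \<Longrightarrow> \<tau> \<in> \<Sigma> \<Longrightarrow> \<tau> \<subseteq> \<sigma> \<Longrightarrow> face \<tau> \<sigma>"
    and "finite \<Sigma>"
  using assms unfolding fan_def by (blast, blast, metis Int_absorb1, blast)

lemma face_subset: "face \<tau> \<sigma> \<Longrightarrow> \<tau> \<subseteq> \<sigma>"
  by (auto simp: face_def)

lemma facet_imp_proper_face: "facet \<tau> \<sigma> \<Longrightarrow> proper_face \<tau> \<sigma>"
  by (auto simp: facet_def proper_face_def)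

text \<open>The span of \<tau> is the span of \<sigma> plus the line through \<open>x\<close>. As
  \<open>m\<close> vanishes on \<sigma> but not at \<open>x\<close>, the coefficient of
  \<open>x\<close> in \<open>w\<close> has to be 0.\<close>

lemma facet_span_kernel:
  assumes "\<sigma> \<subseteq> \<tau>" "dim \<tau> = dim \<sigma> + 1" "m \<in> perp \<sigma>" "x \<in> \<tau>" "m x \<noteq> 0" "w \<in> span \<tau>" "m w = 0"
  shows "w \<in> span \<sigma>"
proof -
  have m: "m \<in> MQ"
    using assms(3) perp_subset_MQ by blast
  have "x \<notin> span \<sigma>"
    using assms perp_span_eq_0 by blast
  then have "span (insert x \<sigma>) = span \<tau>"
    using assms by (intro span_insert_eq_span)
  with assms(6) obtain c where c: "w - c *s x \<in> span \<sigma>"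
    using span_breakdown_eq by blast
  then have "m w - c * m x = 0"
    using perp_span_eq_0[OF assms(3) c] m by (simp add: MQ_diff MQ_scale)
  with assms have "c = 0" by simp
  with c show ?thesis by simp
qed

text \<open>The functional cutting out the facet serves as a height over it; codimension one
  upgrades its zero set from a statement on the cone to one on the whole span.\<close>

lemma facet_obtain_functional:
  assumes "facet \<sigma> \<tau>"
  obtains m where "m \<in> perp \<sigma>" "\<And>x. x \<in> \<tau> \<Longrightarrow> 0 \<le> m x"
    "\<And>w. w \<in> span \<tau> \<Longrightarrow> m w = 0 \<longleftrightarrow> w \<in> span \<sigma>" "\<exists>x\<in>\<tau>. 0 < m x"
proof -
  have sub: "\<sigma> \<subseteq> \<tau>" and dim: "dim \<tau> = dim \<sigma> + 1"
    using assms by (auto simp: facet_def face_subset)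
  obtain m where m: "m \<in> MQ" "\<And>x. x \<in> \<tau> \<Longrightarrow> 0 \<le> m x" "\<sigma> = {x \<in> \<tau>. m x = 0}"
    using assms by (auto simp: facet_def face_def)
  have perp: "m \<in> perp \<sigma>"
    using m by (auto simp: perp_def)
  have "\<sigma> \<noteq> \<tau>"
    using dim by auto
  then obtain x where x: "x \<in> \<tau>" "m x \<noteq> 0"
    using m(3) sub by blast
  then have "\<exists>x\<in>\<tau>. 0 < m x"
    using m(2) by (metis order_le_less)
  moreover have "m w = 0 \<longleftrightarrow> w \<in> span \<sigma>" if "w \<in> span \<tau>" for w
    using facet_span_kernel[OF sub dim perp x that] perp_span_eq_0[OF perp] by blast
  ultimately show thesis
    using m perp by (intro that[of m]) auto
qed

text \<open>Division with remainder: take \<open>x\<close> of least positive height. Subtracting a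
  suitable integer multiple of \<open>x\<close> from \<open>t\<close> leaves a height in the
  interval from 0 to \<open>m x\<close>, right end excluded, and minimality forces it to be
  0.\<close>

lemma lattice_point_minimal_height:
  assumes "m \<in> MQ" "v \<in> N_cone \<tau>" "0 < m v"
  obtains x where "x \<in> N_cone \<tau>" "0 < m x"
    "\<And>t. t \<in> N_cone \<tau> \<Longrightarrow> \<exists>k::int. m (t - of_int k *s x) = 0"
proof -
  obtain q :: nat where q: "q > 0" "\<And>v. v \<in> N \<Longrightarrow> of_nat q * m v \<in> \<int>"
    using MQ_common_denominator[OF assms(1)] by blast
  \<comment> \<open>\<open>h\<close> clears the denominators of the height and reads it as a natural
    number, so that a least one exists by well-ordering.\<close>
  define h where "h v = nat \<lfloor>of_nat q * m v\<rfloor>" for v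
  have h: "of_nat (h v) = of_nat q * m v" if "v \<in> N_cone \<tau>" "0 \<le> m v" for v
    using q(2)[of v] that N_cone_subset_N[of \<tau>] by (auto simp: h_def elim!: Ints_cases)
  obtain x where x: "x \<in> N_cone \<tau>" "0 < m x" and min: "\<And>y. y \<in> N_cone \<tau> \<Longrightarrow> 0 < m y \<Longrightarrow> h x \<le> h y"
    using ex_has_least_nat[of "\<lambda>v. v \<in> N_cone \<tau> \<and> 0 < m v" v h] assms(2,3) by blast
  have min': "m x \<le> m y" if "y \<in> N_cone \<tau>" "0 < m y" for y
  proof -
    have "(of_nat (h x) :: rat) \<le> of_nat (h y)"
      using min[OF that] by simp
    with that x q(1) show ?thesis by (simp add: h)
  qed
  have "\<exists>k::int. m (t - of_int k *s x) = 0" if t: "t \<in> N_cone \<tau>" for t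
  proof -
    define k where "k = \<lfloor>m t / m x\<rfloor>"
    let ?r = "t - of_int k *s x"
    have r: "?r \<in> N_cone \<tau>"
      using t x(1) unfolding N_cone_def by (intro group_closure.diff group_closure_of_int_scale)
    have "of_int k \<le> m t / m x" "m t / m x < of_int k + 1"
      unfolding k_def by linarith+
    then have "0 \<le> m ?r" "m ?r < m x"
      using x(2) assms(1) by (simp_all add: MQ_diff MQ_scale field_simps)
    with min'[OF r] show ?thesis
      by (intro exI[of _ k]) linarith
  qed
  with x that show thesis by blast
qed

text \<open>A lattice point \<open>v\<close> of least positive height generates modulo
  \<open>N_cone \<sigma>\<close>, but it need not lie in \<tau>. Adding a large multiple of the sum
  of the generators of \<sigma> keeps its class and its height and moves it into \<tau>.\<close>

lemma facet_lattice_generator: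
  assumes "rational_polyhedral_cone \<sigma>" "rational_polyhedral_cone \<tau>" "facet \<sigma> \<tau>"
  obtains x where "x \<in> \<tau>" "x \<in> N" "\<And>v. v \<in> N_cone \<tau> \<Longrightarrow> \<exists>k::int. v - of_int k *s x \<in> N_cone \<sigma>"
proof -
  obtain m where m: "m \<in> perp \<sigma>" "\<And>x. x \<in> \<tau> \<Longrightarrow> 0 \<le> m x"
    "\<And>w. w \<in> span \<tau> \<Longrightarrow> m w = 0 \<longleftrightarrow> w \<in> span \<sigma>" "\<exists>x\<in>\<tau>. 0 < m x"
    using facet_obtain_functional[OF assms(3)] by blast
  have mMQ: "m \<in> MQ"
    using m(1) perp_subset_MQ by blast
  have sub: "\<sigma> \<subseteq> \<tau>"
    using assms(3) by (auto simp: facet_def face_subset)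
  obtain T where T: "finite T" "T \<subseteq> N" "\<tau> = cone_generated T"
    using assms(2) by (auto simp: rational_polyhedral_cone_def)
  obtain S where S: "finite S" "S \<subseteq> N" "\<sigma> = cone_generated S"
    using assms(1) by (auto simp: rational_polyhedral_cone_def)
  have T\<tau>: "T \<subseteq> \<tau>"
    using generators_subset_cone T by simp
  \<comment> \<open>Some generator has positive height, since otherwise \<open>m\<close> would
    vanish on all of \<tau>.\<close>
  obtain t where t: "t \<in> T" "0 < m t"
  proof -
    have "\<exists>t\<in>T. 0 < m t"
    proof (rule ccontr)
      assume "\<not> ?thesis"
      then have "\<And>t. t \<in> T \<Longrightarrow> m t = 0"
        using T\<tau> m(2) by (metis in_mono order_le_less)
      then have "m \<in> perp \<tau>"
        using mMQ cone_subset_span[of T] T(3) by (intro perp_spanI[of m T]) auto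
      with m(4) show False
        using perp_eq_0[of m \<tau>] by force
    qed
    with that show thesis by blast
  qed
  have "t \<in> N_cone \<tau>"
    using t T\<tau> T(2) by (intro N_cone_base) auto
  then obtain v where v: "v \<in> N_cone \<tau>" "0 < m v"
      "\<And>w. w \<in> N_cone \<tau> \<Longrightarrow> \<exists>k::int. m (w - of_int k *s v) = 0"
    using lattice_point_minimal_height[OF mMQ _ t(2), of \<tau>] by metis
  \<comment> \<open>With this \<open>c\<close> the vector \<open>v - c *s t\<close> has height 0, so
    it lies in the span of \<sigma> and can be absorbed by \<sigma>; adding \<open>c *s t\<close>
    back stays inside \<tau> because \<open>c\<close> is nonnegative.\<close>
  define c where "c = m v / m t"
  have c: "0 \<le> c" "m (v - c *s t) = 0"
    using t v mMQ by (auto simp: c_def MQ_diff MQ_scale)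
  have "v - c *s t \<in> span \<tau>"
    using v(1) N_cone_subset_span t T\<tau> by (intro span_diff span_scale) (auto intro: span_base)
  with c m(3) have "v - c *s t \<in> span \<sigma>" by blast
  then have "v - c *s t \<in> span S"
    using cone_subset_span[of S] S(3) span_mono[of \<sigma> "span S"] by (auto simp: span_span)
  then obtain j :: nat where j: "v - c *s t + of_nat j *s \<Sum>S \<in> \<sigma>"
    using span_absorbed_by_cone[OF S(1)] S(3) by metis
  define x where "x = v + of_nat j *s \<Sum>S"
  have "c *s t + (v - c *s t + of_nat j *s \<Sum>S) \<in> cone_generated T"
    using j sub T(3) t(1) T\<tau> c(1) by (intro cone_add[OF cone_scale]) auto
  then have x\<tau>: "x \<in> \<tau>"
    by (simp add: x_def T(3) algebra_simps)
  have p: "of_nat j *s \<Sum>S \<in> N_cone \<sigma>"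
  proof -
    have "\<Sum>S \<in> N_cone \<sigma>"
      using S sum_generators_in_N sum_generators_in_cone by (intro N_cone_base) auto
    then show ?thesis
      using group_closure_of_int_scale[of "\<Sum>S" "\<sigma> \<inter> N" "int j"] by (simp add: N_cone_def)
  qed
  have xN: "x \<in> N"
    using v(1) p N_cone_subset_N unfolding x_def N_def by (intro group_closure_add) auto
  have mx: "m x = m v"
    using mMQ perp_span_eq_0[OF m(1)] p N_cone_subset_span by (auto simp: x_def MQ_add)
  have "\<exists>k::int. w - of_int k *s x \<in> N_cone \<sigma>" if w: "w \<in> N_cone \<tau>" for w
  proof -
    obtain k :: int where "m (w - of_int k *s v) = 0"
      using v(3)[OF w] by blast
    then have k: "m (w - of_int k *s x) = 0"
      using mMQ mx by (simp add: MQ_diff MQ_scale)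
    have "w - of_int k *s x \<in> N_cone \<tau>"
      using w N_cone_base[OF x\<tau> xN] unfolding N_cone_def
      by (intro group_closure.diff group_closure_of_int_scale)
    then have "w - of_int k *s x \<in> N" "w - of_int k *s x \<in> span \<tau>"
      using N_cone_subset_N N_cone_subset_span by blast+
    with k m(3) N_cone_eq[OF assms(1)] show ?thesis by blast
  qed
  with x\<tau> xN that show thesis by blast
qed

text \<open>Turns the quotient condition in the definition of \<open>normal_gen\<close> into one on
  representatives, on which all later computations rest.\<close>

lemma cosets_cyclic_iff:
  assumes "x \<in> N_cone \<tau>"
  shows "cosets (N_cone \<tau>) (N_cone \<sigma>) = {(of_int k *s x) +o N_cone \<sigma> | k :: int. True} \<longleftrightarrow>
    (\<forall>v\<in>N_cone \<tau>. \<exists>k::int. v - of_int k *s x \<in> N_cone \<sigma>)" (is "?L = ?R \<longleftrightarrow> ?P")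
proof
  assume eq: "?L = ?R"
  show ?P
  proof
    fix v assume "v \<in> N_cone \<tau>"
    then have "v +o N_cone \<sigma> \<in> ?R"
      unfolding eq[symmetric] cosets_def by blast
    then obtain k :: int where k: "v +o N_cone \<sigma> = (of_int k *s x) +o N_cone \<sigma>" by blast
    have "v + 0 \<in> v +o N_cone \<sigma>"
      by (intro set_plus_intro2) (simp add: N_cone_def)
    with k show "\<exists>k::int. v - of_int k *s x \<in> N_cone \<sigma>"
      using set_plus_imp_minus by fastforce
  qed
next
  assume P: ?P
  have "v +o N_cone \<sigma> \<in> ?R" if "v \<in> N_cone \<tau>" for v
    using P that group_closure_coset_eq unfolding N_cone_def by blast
  moreover have "of_int k *s x \<in> N_cone \<tau>" for k :: int
    using assms unfolding N_cone_def by (rule group_closure_of_int_scale)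
  ultimately show "?L = ?R"
    unfolding cosets_def by blast
qed

text \<open>This justifies the definite description. For uniqueness, the heights of two generators
  in \<tau> are positive integer multiples of each other, hence equal, so the difference of the
  generators is a lattice point in the span of \<sigma> and belongs to
  \<open>N_cone \<sigma>\<close> by saturation.\<close>

lemma normal_gen:
  assumes "rational_polyhedral_cone \<sigma>" "rational_polyhedral_cone \<tau>" "facet \<sigma> \<tau>"
  obtains x where "x \<in> \<tau>" "x \<in> N" "x \<notin> span \<sigma>" "normal_gen \<tau> \<sigma> = x +o N_cone \<sigma>"
    "\<And>v. v \<in> N_cone \<tau> \<Longrightarrow> \<exists>k::int. v - of_int k *s x \<in> N_cone \<sigma>"
proof -
  obtain m where m: "m \<in> perp \<sigma>" "\<And>x. x \<in> \<tau> \<Longrightarrow> 0 \<le> m x"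
    "\<And>w. w \<in> span \<tau> \<Longrightarrow> m w = 0 \<longleftrightarrow> w \<in> span \<sigma>" "\<exists>x\<in>\<tau>. 0 < m x"
    using facet_obtain_functional[OF assms(3)] by blast
  have mMQ: "m \<in> MQ"
    using m(1) perp_subset_MQ by blast
  let ?gen = "\<lambda>x. \<forall>v\<in>N_cone \<tau>. \<exists>k::int. v - of_int k *s x \<in> N_cone \<sigma>"
  have height: "\<exists>k::int. m v = of_int k * m x" if "?gen x" "v \<in> N_cone \<tau>" for x v
  proof -
    from that obtain k :: int where "v - of_int k *s x \<in> N_cone \<sigma>"
      by meson
    then have "m (v - of_int k *s x) = 0"
      using perp_span_eq_0[OF m(1)] N_cone_subset_span by blast
    then show ?thesis
      using mMQ by (auto simp: MQ_diff MQ_scale)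
  qed
  \<comment> \<open>If a generator had height 0, so would every lattice point of \<tau>, and
    \<open>m\<close> would vanish on \<tau>.\<close>
  have pos: "0 < m x" if "x \<in> \<tau>" "x \<in> N" "?gen x" for x
  proof (rule ccontr)
    assume "\<not> 0 < m x"
    with m(2) that have "m x = 0" by force
    then have zero: "m v = 0" if "v \<in> N_cone \<tau>" for v
      using height[OF \<open>?gen x\<close> that] by auto
    obtain T where T: "finite T" "T \<subseteq> N" "\<tau> = cone_generated T"
      using assms(2) by (auto simp: rational_polyhedral_cone_def)
    have "m t = 0" if "t \<in> T" for t
      using that T generators_subset_cone by (intro zero N_cone_base) auto
    then have "m \<in> perp \<tau>"
      using mMQ cone_subset_span[of T] T(3) by (intro perp_spanI[of m T]) auto
    with m(4) show False
      using perp_eq_0[of m \<tau>] by force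
  qed
  have unique: "x +o N_cone \<sigma> = y +o N_cone \<sigma>"
    if x: "x \<in> \<tau>" "x \<in> N" "?gen x" and y: "y \<in> \<tau>" "y \<in> N" "?gen y" for x y
  proof -
    obtain k l :: int where kl: "m x = of_int k * m y" "m y = of_int l * m x"
      using height[OF y(3) N_cone_base[OF x(1,2)]] height[OF x(3) N_cone_base[OF y(1,2)]] by blast
    have "0 < m x" "0 < m y"
      using pos[OF x] pos[OF y] by blast+
    with kl have "k > 0" "k * l = 1"
    proof -
      show "k > 0"
        using kl(1) \<open>0 < m x\<close> \<open>0 < m y\<close> by (simp add: zero_less_mult_iff)
      have "m x = of_int (k * l) * m x"
        by (simp only: of_int_mult mult.assoc flip: kl)
      then have "of_int (k * l) = (1 :: rat)"
        using \<open>0 < m x\<close> by simp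
      then show "k * l = 1"
        by (simp only: of_int_eq_1_iff)
    qed
    then have "k = 1"
      using pos_zmult_eq_1_iff by blast
    with kl have "m (x - y) = 0"
      using mMQ by (simp add: MQ_diff)
    moreover have "x - y \<in> span \<tau>"
      using x y by (intro span_diff) (auto intro: span_base)
    moreover have "x - y \<in> N"
      using x y by (simp add: N_def group_closure.diff)
    ultimately have "x - y \<in> N_cone \<sigma>"
      using m(3) N_cone_eq[OF assms(1)] by blast
    then show ?thesis
      unfolding N_cone_def by (rule group_closure_coset_eq)
  qed
  obtain x where x: "x \<in> \<tau>" "x \<in> N" "\<And>v. v \<in> N_cone \<tau> \<Longrightarrow> \<exists>k::int. v - of_int k *s x \<in> N_cone \<sigma>"
    using facet_lattice_generator[OF assms] by blast
  have iff: "cosets (N_cone \<tau>) (N_cone \<sigma>) = {(of_int k *s y) +o N_cone \<sigma> | k :: int. True} \<longleftrightarrow> ?gen y"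
    if "y \<in> \<tau> \<inter> N" for y
    using that by (intro cosets_cyclic_iff N_cone_base) auto
  have "normal_gen \<tau> \<sigma> = x +o N_cone \<sigma>"
    unfolding normal_gen_def
  proof (rule the_equality)
    show "\<exists>y\<in>\<tau> \<inter> N. x +o N_cone \<sigma> = y +o N_cone \<sigma> \<and>
        cosets (N_cone \<tau>) (N_cone \<sigma>) = {(of_int k *s y) +o N_cone \<sigma> | k :: int. True}"
      using x iff by (intro bexI[of _ x]) auto
  next
    fix \<nu>
    assume "\<exists>y\<in>\<tau> \<inter> N. \<nu> = y +o N_cone \<sigma> \<and>
        cosets (N_cone \<tau>) (N_cone \<sigma>) = {(of_int k *s y) +o N_cone \<sigma> | k :: int. True}"
    then obtain y where y: "y \<in> \<tau> \<inter> N" "\<nu> = y +o N_cone \<sigma>"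
      "cosets (N_cone \<tau>) (N_cone \<sigma>) = {(of_int k *s y) +o N_cone \<sigma> | k :: int. True}"
      by blast
    have "?gen y"
      using y(3) iff[OF y(1)] by (rule rev_iffD1)
    with unique[of y x] x y(1,2) show "\<nu> = x +o N_cone \<sigma>" by simp
  qed
  moreover have "x \<notin> span \<sigma>"
    using pos[of x] x perp_span_eq_0[OF m(1)] by force
  ultimately show thesis
    using x that by blast
qed

subsection \<open>Projections along the complements\<close>

text \<open>
  Evaluation on a basis of the span of \<open>\<sigma>\<close> is injective on \<open>\<Psi> \<sigma>\<close>, hence, by dimension,
  every tuple of values is attained on \<open>\<Psi> \<sigma>\<close>.
\<close>

lemma complement_decomposition:
  assumes "M.subspace W" "W \<subseteq> MQ" "M.dim W = dim \<sigma>" "W \<inter> perp \<sigma> = {0}" "m \<in> MQ"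
  obtains w where "w \<in> W" "m - w \<in> perp \<sigma>"
proof -
  obtain B where B: "B \<subseteq> \<sigma>" "independent B" "\<sigma> \<subseteq> span B" "card B = dim \<sigma>"
    using basis_exists by blast
  have finB: "finite B"
    using B(2) finiteI_independent by blast
  obtain P where P: "P \<subseteq> W" "M.independent P" "W \<subseteq> M.span P" "card P = M.dim W"
    using M.basis_exists by blast
  have spanP: "M.span P = W"
    using P(1,3) assms(1) by (rule M.span_subspace)
  \<comment> \<open>\<open>R\<close> records the tuple of values on \<open>B\<close>, padded by 0 so
    that it is again a function on the whole type.\<close>
  define R :: "('v \<Rightarrow> rat) \<Rightarrow> 'v \<Rightarrow> rat" where "R f = (\<lambda>x. if x \<in> B then f x else 0)" for f
  interpret R: Vector_Spaces.linear scaleM scaleM R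
    by unfold_locales (auto simp: R_def scaleM_def fun_eq_iff algebra_simps)
  have perpI: "f \<in> perp \<sigma>" if "f \<in> MQ" "R f = 0" for f
  proof (rule perp_spanI[OF that(1) _ B(3)])
    fix x assume "x \<in> B"
    then show "f x = 0"
      using fun_cong[OF that(2), of x] by (simp add: R_def)
  qed
  have inj: "inj_on R (M.span P)"
    unfolding spanP
  proof (rule inj_onI)
    fix f g assume fg: "f \<in> W" "g \<in> W" "R f = R g"
    then have "f - g \<in> W" "R (f - g) = 0"
      using assms(1) by (auto simp: M.subspace_diff R.diff)
    then have "f - g \<in> W \<inter> perp \<sigma>"
      using perpI assms(2) by blast
    with assms(4) show "f = g" by auto
  qed
  define I where "I = (\<lambda>b x. if x = b then 1 else 0 :: rat) ` B"
  have I: "finite I" "card I \<le> card B"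
    using finB by (auto simp: I_def card_image_le)
  have R_span: "R f \<in> M.span I" for f
  proof -
    have "R f = (\<Sum>b\<in>B. scaleM (f b) (\<lambda>x. if x = b then 1 else 0))"
      using finB by (auto simp: R_def scaleM_def fun_eq_iff sum_fun_apply if_distrib cong: if_cong)
    then show ?thesis
      by (auto simp: I_def intro!: M.span_sum M.span_scale intro: M.span_base)
  qed
  \<comment> \<open>Otherwise \<open>R m\<close> and the images of \<open>P\<close> would be
    \<open>card B + 1\<close> independent vectors in the span of at most \<open>card B\<close>
    vectors.\<close>
  have "R m \<in> M.span (R ` P)"
  proof (rule ccontr)
    assume not: "R m \<notin> M.span (R ` P)"
    have "M.independent (R ` P)"
      using P(2) inj by (rule R.independent_injective_image)
    with not have ind: "M.independent (insert (R m) (R ` P))"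
      by (rule M.independent_insertI)
    have "insert (R m) (R ` P) \<subseteq> M.span I"
      using R_span by auto
    from M.independent_span_bound[OF I(1) ind this]
    have "finite (insert (R m) (R ` P))" "card (insert (R m) (R ` P)) \<le> card B"
      using I(2) by (auto intro: order_trans)
    moreover have "R m \<notin> R ` P"
      using not M.span_base[of "R m" "R ` P"] by blast
    moreover have "card (R ` P) = card P"
      by (rule card_image[OF inj_on_subset[OF inj M.span_superset]])
    ultimately show False
      using P(4) B(4) assms(3) by simp
  qed
  then obtain w where w: "w \<in> W" "R m = R w"
    using R.span_image[of P] spanP by auto
  have "m - w \<in> MQ"
    using w(1) assms(2,5) subspace_MQ by (auto intro: M.subspace_diff)
  moreover have "R (m - w) = 0"
    using w(2) by (simp add: R.diff)
  ultimately show thesis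
    using that[OF w(1)] perpI by blast
qed

lemma complementsD:
  assumes "complements \<Sigma> \<Psi>" "\<sigma> \<in> \<Sigma>"
  shows "\<Psi> \<sigma> \<subseteq> MQ" "M.subspace (\<Psi> \<sigma>)" "M.dim (\<Psi> \<sigma>) = dim \<sigma>" "\<Psi> \<sigma> \<inter> perp \<sigma> = {0}"
  using assms unfolding complements_def by auto

text \<open>Two candidates differ by an element of the complement that also lies in M(\<sigma>), and
  these meet only in 0.\<close>

lemma proj_unique:
  assumes "complements \<Sigma> \<Psi>" "\<sigma> \<in> \<Sigma>" "u \<in> perp \<sigma>" "m - u \<in> \<Psi> \<sigma>"
  shows "proj \<Psi> \<sigma> m = u"
  unfolding proj_def
proof (rule the_equality)
  fix w assume w: "w \<in> perp \<sigma> \<and> m - w \<in> \<Psi> \<sigma>"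
  have "(m - u) - (m - w) \<in> \<Psi> \<sigma>" "w - u \<in> perp \<sigma>"
    using w assms(3,4) complementsD(2)[OF assms(1,2)] subspace_perp by (blast intro: M.subspace_diff)+
  then have "w - u \<in> \<Psi> \<sigma> \<inter> perp \<sigma>" by simp
  then show "w = u"
    unfolding complementsD(4)[OF assms(1,2)] by simp
qed (use assms in blast)

lemma
  assumes "complements \<Sigma> \<Psi>" "\<sigma> \<in> \<Sigma>" "m \<in> MQ"
  shows proj_in_perp: "proj \<Psi> \<sigma> m \<in> perp \<sigma>"
    and diff_proj_in_complement: "m - proj \<Psi> \<sigma> m \<in> \<Psi> \<sigma>"
proof -
  obtain w where w: "w \<in> \<Psi> \<sigma>" "m - w \<in> perp \<sigma>"
    using complement_decomposition complementsD[OF assms(1,2)] assms(3) by metis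
  have "m - (m - w) \<in> \<Psi> \<sigma>"
    using w(1) by simp
  then have "proj \<Psi> \<sigma> m = m - w"
    using proj_unique[OF assms(1,2) w(2)] by blast
  with w show "proj \<Psi> \<sigma> m \<in> perp \<sigma>" "m - proj \<Psi> \<sigma> m \<in> \<Psi> \<sigma>" by simp_all
qed

lemma proj_add_perp:
  assumes "complements \<Sigma> \<Psi>" "\<sigma> \<in> \<Sigma>" "m \<in> MQ" "g \<in> perp \<sigma>"
  shows "proj \<Psi> \<sigma> (m + g) = proj \<Psi> \<sigma> m + g"
  using assms proj_in_perp[OF assms(1-3)] diff_proj_in_complement[OF assms(1-3)]
  by (intro proj_unique[OF assms(1,2)]) (auto simp: algebra_simps intro: M.subspace_add[OF subspace_perp])

text \<open>The part of \<open>m\<close> removed by the first projection lies in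
  \<open>\<Psi> \<sigma>\<close>, hence in the larger \<open>\<Psi> \<tau>\<close>, which the second
  projection kills. This is where the nesting of the complements enters.\<close>

lemma proj_proj:
  assumes "complements \<Sigma> \<Psi>" "\<sigma> \<in> \<Sigma>" "\<tau> \<in> \<Sigma>" "proper_face \<sigma> \<tau>" "m \<in> MQ"
  shows "proj \<Psi> \<tau> (proj \<Psi> \<sigma> m) = proj \<Psi> \<tau> m"
proof -
  let ?u = "proj \<Psi> \<sigma> m"
  have u: "?u \<in> MQ"
    using proj_in_perp[OF assms(1,2,5)] perp_subset_MQ by blast
  have "m - ?u \<in> \<Psi> \<tau>"
    using diff_proj_in_complement[OF assms(1,2,5)] assms(1-4) unfolding complements_def by blast
  then have "(m - ?u) + (?u - proj \<Psi> \<tau> ?u) \<in> \<Psi> \<tau>"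
    using diff_proj_in_complement[OF assms(1,3) u] complementsD(2)[OF assms(1,3)]
    by (intro M.subspace_add)
  then have "m - proj \<Psi> \<tau> ?u \<in> \<Psi> \<tau>" by simp
  with proj_unique[OF assms(1,3) proj_in_perp[OF assms(1,3) u]] show ?thesis by simp
qed

text \<open>Independence of both representatives. Two local equations differ by an element of
  M(\<tau>), which \<pi>_\<sigma> fixes and which vanishes at \<open>x\<close>; two lattice
  representatives differ by an element of \<open>N_cone \<sigma>\<close>, on which M(\<sigma>)
  vanishes.\<close>

lemma pairing_proj:
  assumes "complements \<Sigma> \<Psi>" "Q_Cartier_divisor \<Sigma> D" "\<sigma> \<in> \<Sigma>" "\<tau> \<in> \<Sigma>" "\<sigma> \<subseteq> \<tau>"
    and "d \<in> D \<tau>" "x \<in> \<tau>"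
  shows "pairing (proj \<Psi> \<sigma> ` D \<tau>) (x +o N_cone \<sigma>) = proj \<Psi> \<sigma> d x"
proof -
  obtain d0 where d0: "d0 \<in> MQ" "D \<tau> = d0 +o perp \<tau>"
    using assms(2,4) unfolding Q_Cartier_divisor_def M_cone_def cosets_def by blast
  then have "d - d0 \<in> perp \<tau>"
    using assms(6) set_plus_imp_minus by blast
  then have d: "d \<in> MQ"
    using M.subspace_add[OF subspace_MQ d0(1), of "d - d0"] perp_subset_MQ by auto
  have *: "f z = proj \<Psi> \<sigma> d x" if f: "f \<in> proj \<Psi> \<sigma> ` D \<tau>" and z: "z \<in> x +o N_cone \<sigma>" for f z
  proof -
    obtain d1 where d1: "d1 \<in> D \<tau>" "f = proj \<Psi> \<sigma> d1"
      using f by blast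
    have "d1 - d0 \<in> perp \<tau>"
      using d1(1) unfolding d0(2) by (rule set_plus_imp_minus)
    from M.subspace_diff[OF subspace_perp this \<open>d - d0 \<in> perp \<tau>\<close>]
    have "(d1 - d0) - (d - d0) \<in> perp \<tau>" .
    then have g: "d1 - d \<in> perp \<tau>" by simp
    then have "d1 - d \<in> perp \<sigma>"
      using perp_antimono[OF assms(5)] by blast
    from proj_add_perp[OF assms(1,3) d this] have f': "f = proj \<Psi> \<sigma> d + (d1 - d)"
      by (simp add: d1(2))
    have pd: "proj \<Psi> \<sigma> d \<in> perp \<sigma>"
      using proj_in_perp[OF assms(1,3) d] .
    then have fp: "f \<in> perp \<sigma>"
      unfolding f' using \<open>d1 - d \<in> perp \<sigma>\<close> by (intro M.subspace_add subspace_perp)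
    have "z - x \<in> N_cone \<sigma>"
      using z by (rule set_plus_imp_minus)
    then have "f (z - x) = 0"
      using fp perp_span_eq_0 N_cone_subset_span by blast
    then have "f z = f x"
      using fp perp_subset_MQ[of \<sigma>] by (auto simp: MQ_diff)
    also have "\<dots> = proj \<Psi> \<sigma> d x"
      using perp_eq_0[OF g assms(7)] by (simp add: f')
    finally show ?thesis .
  qed
  have "x + 0 \<in> x +o N_cone \<sigma>"
    by (intro set_plus_intro2) (simp add: N_cone_def)
  with assms(6) show ?thesis
    unfolding pairing_def by (intro the_equality) (use * in \<open>auto\<close>)
qed

subsection \<open>Cones of relative dimension two\<close>

text \<open>\<open>a\<close> and \<open>b\<close> are linear coordinates on the plane
  span(\<gamma>)/span(\<sigma>): \<open>a\<close> cuts out the face \<sigma>, \<open>x\<close> and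
  \<open>y\<close> form a basis of the plane, and \<open>b\<close> is chosen to kill
  \<open>x\<close> and be 1 at \<open>y\<close>. Every functional in M(\<sigma>) factors through
  this plane.\<close>

lemma codim2_coordinates:
  assumes "face \<sigma> \<gamma>" "dim \<gamma> = dim \<sigma> + 2"
  obtains a b x y where "a \<in> perp \<sigma>" "\<And>v. v \<in> \<gamma> \<Longrightarrow> 0 \<le> a v" "\<And>v. v \<in> \<gamma> \<Longrightarrow> a v = 0 \<longleftrightarrow> v \<in> \<sigma>"
    "b \<in> perp \<sigma>" "x \<in> \<gamma>" "0 < a x" "b x = 0" "y \<in> \<gamma>" "b y = 1"
    "\<And>m. m \<in> perp \<sigma> \<Longrightarrow> \<exists>\<alpha> \<beta>. \<forall>v\<in>\<gamma>. m v = \<alpha> * a v + \<beta> * b v"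
proof -
  have sub: "\<sigma> \<subseteq> \<gamma>"
    using assms(1) by (rule face_subset)
  obtain a where a: "a \<in> MQ" "\<And>v. v \<in> \<gamma> \<Longrightarrow> 0 \<le> a v" "\<sigma> = {v \<in> \<gamma>. a v = 0}"
    using assms(1) by (auto simp: face_def)
  then have ap: "a \<in> perp \<sigma>"
    by (auto simp: perp_def)
  have "\<sigma> \<noteq> \<gamma>"
    using assms(2) by auto
  then obtain x where x: "x \<in> \<gamma>" "0 < a x"
    using a(2,3) sub by (metis (mono_tags, lifting) Collect_cong mem_Collect_eq order_le_less subsetI subset_antisym)
  then have x\<sigma>: "x \<notin> span \<sigma>"
    using perp_span_eq_0[OF ap] by force
  have "\<not> \<gamma> \<subseteq> span (insert x \<sigma>)"
    using dim_mono[of \<gamma> "insert x \<sigma>"] assms(2) x\<sigma> by (auto simp: dim_insert)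
  then obtain y where y: "y \<in> \<gamma>" "y \<notin> span (insert x \<sigma>)" by blast
  obtain b where b: "b \<in> perp (insert x \<sigma>)" "b y = 1"
    using perp_separates[OF y(2)] by blast
  then have bp: "b \<in> perp \<sigma>" "b x = 0"
    by (auto simp: perp_def)
  have span: "span (insert y (insert x \<sigma>)) = span \<gamma>"
    using sub x y x\<sigma> assms(2) by (intro span_insert_eq_span) (auto simp: dim_insert)
  have rep: "\<exists>\<alpha> \<beta>. \<forall>v\<in>\<gamma>. m v = \<alpha> * a v + \<beta> * b v" if m: "m \<in> perp \<sigma>" for m
  proof (intro exI ballI)
    fix v assume "v \<in> \<gamma>"
    then have "v \<in> span (insert y (insert x \<sigma>))"
      by (simp add: span span_base)
    then obtain p q where pq: "v - q *s y - p *s x \<in> span \<sigma>"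
      unfolding span_breakdown_eq by blast
    have coords: "f v = p * f x + q * f y" if "f \<in> perp \<sigma>" for f
    proof -
      have "f (v - q *s y - p *s x) = 0"
        using perp_span_eq_0[OF that pq] .
      moreover have "f \<in> MQ"
        using that perp_subset_MQ by blast
      ultimately show ?thesis
        by (simp add: MQ_diff MQ_scale)
    qed
    \<comment> \<open>Evaluating \<open>b\<close> isolates \<open>q\<close>, and evaluating
      \<open>a\<close> then gives \<open>p\<close>. Substituting both into
      \<open>m v = p * m x + q * m y\<close> and collecting \<open>a v\<close> and
      \<open>b v\<close> yields the coefficients.\<close>
    have "q = b v" "p = (a v - b v * a y) / a x"
      using coords[OF bp(1)] coords[OF ap] bp b(2) x by auto
    moreover have "(m x / a x) * a v + (m y - m x / a x * a y) * b v =
        (a v - b v * a y) / a x * m x + b v * m y"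
      by (simp only: divide_inverse ring_distribs mult_ac)
    ultimately show "m v = (m x / a x) * a v + (m y - m x / a x * a y) * b v"
      using coords[OF m] by metis
  qed
  have kernel: "a v = 0 \<longleftrightarrow> v \<in> \<sigma>" if "v \<in> \<gamma>" for v
    using a(3) that by simp
  show thesis
    by (rule that[OF ap a(2) kernel bp(1) x bp(2) y(1) b(2) rep])
qed

text \<open>The image of \<gamma> modulo the span of \<sigma> is a plane cone, and the slope
  \<open>b / a\<close> orders its rays; the two extreme slopes give the two intermediate faces. Any
  functional cutting out an intermediate face is on \<gamma> a nonzero multiple of
  \<open>b - c * a\<close>, and its nonnegativity forces \<open>c\<close> to be extreme.\<close>

lemma diamond:
  assumes "fan \<Sigma>" "\<sigma> \<in> \<Sigma>" "\<gamma> \<in> \<Sigma>" "face \<sigma> \<gamma>" "dim \<gamma> = dim \<sigma> + 2"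
  obtains a b c\<^sub>1 c\<^sub>2 \<tau>\<^sub>1 \<tau>\<^sub>2 where
    "\<forall>v\<in>\<gamma>. 0 \<le> a v \<and> (a v = 0 \<longleftrightarrow> v \<in> \<sigma>) \<and> c\<^sub>1 * a v \<le> b v \<and> b v \<le> c\<^sub>2 * a v"
    "a \<in> perp \<sigma>" "b \<in> perp \<sigma>"
    "\<tau>\<^sub>1 \<noteq> \<tau>\<^sub>2" "\<tau>\<^sub>1 = {v \<in> \<gamma>. b v = c\<^sub>1 * a v}" "\<tau>\<^sub>2 = {v \<in> \<gamma>. b v = c\<^sub>2 * a v}"
    "{\<tau> \<in> \<Sigma>. facet \<sigma> \<tau> \<and> facet \<tau> \<gamma>} = {\<tau>\<^sub>1, \<tau>\<^sub>2}"
proof -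
  obtain a b x y where ab: "a \<in> perp \<sigma>" "\<And>v. v \<in> \<gamma> \<Longrightarrow> 0 \<le> a v" "\<And>v. v \<in> \<gamma> \<Longrightarrow> a v = 0 \<longleftrightarrow> v \<in> \<sigma>"
    "b \<in> perp \<sigma>" and xy: "x \<in> \<gamma>" "0 < a x" "b x = 0" "y \<in> \<gamma>" "b y = 1"
    and rep: "\<And>m. m \<in> perp \<sigma> \<Longrightarrow> \<exists>\<alpha> \<beta>. \<forall>v\<in>\<gamma>. m v = \<alpha> * a v + \<beta> * b v"
    using codim2_coordinates[OF assms(4,5)] by blast
  have sub: "\<sigma> \<subseteq> \<gamma>"
    using assms(4) by (rule face_subset)
  have MQ: "a \<in> MQ" "b \<in> MQ"
    using ab perp_subset_MQ by blast+
  obtain T where T: "finite T" "T \<subseteq> N" "\<gamma> = cone_generated T"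
    using fanD(1)[OF assms(1,3)] by (auto simp: rational_polyhedral_cone_def)
  have T\<gamma>: "T \<subseteq> \<gamma>"
    using T generators_subset_cone by simp
  \<comment> \<open>The other generators lie in \<sigma>, where \<open>a\<close> and
    \<open>b\<close> both vanish and the slope is meaningless.\<close>
  define T' where "T' = {t \<in> T. 0 < a t}"
  have T': "finite T'" "\<And>t. t \<in> T \<Longrightarrow> t \<notin> T' \<Longrightarrow> a t = 0 \<and> b t = 0"
  proof -
    show "finite T'"
      using T(1) by (simp add: T'_def)
    fix t assume t: "t \<in> T" "t \<notin> T'"
    then have "a t = 0"
      using ab(2)[of t] T\<gamma> by (force simp: T'_def)
    with ab(3,4) t T\<gamma> show "a t = 0 \<and> b t = 0"
      by (auto dest: perp_eq_0)
  qed
  have "T' \<noteq> {}"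
  proof
    assume "T' = {}"
    then have "\<And>t. t \<in> T \<Longrightarrow> 0 \<le> (- a) t"
      using T' by force
    moreover have "- a \<in> MQ"
      using MQ(1) subspace_MQ by (rule M.subspace_neg[rotated])
    ultimately have "0 \<le> (- a) x"
      using cone_nonneg xy(1) T(3) by blast
    with xy(2) show False by simp
  qed
  define slope where "slope v = b v / a v" for v
  define c\<^sub>1 where "c\<^sub>1 = Min (slope ` T')"
  define c\<^sub>2 where "c\<^sub>2 = Max (slope ` T')"
  have "c\<^sub>1 \<in> slope ` T'" "c\<^sub>2 \<in> slope ` T'"
    using T'(1) \<open>T' \<noteq> {}\<close> by (auto simp: c\<^sub>1_def c\<^sub>2_def)
  \<comment> \<open>Generators attaining the extreme slopes: each lies on its own face, outside
    \<sigma>, and later witnesses that the other face is not all of \<gamma>.\<close>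
  then obtain s\<^sub>1 s\<^sub>2 where "s\<^sub>1 \<in> T'" "c\<^sub>1 = slope s\<^sub>1" "s\<^sub>2 \<in> T'" "c\<^sub>2 = slope s\<^sub>2" by blast
  then have s: "s\<^sub>1 \<in> \<gamma>" "0 < a s\<^sub>1" "b s\<^sub>1 = c\<^sub>1 * a s\<^sub>1" "s\<^sub>2 \<in> \<gamma>" "0 < a s\<^sub>2" "b s\<^sub>2 = c\<^sub>2 * a s\<^sub>2"
    using T\<gamma> by (auto simp: T'_def slope_def)
  define f where "f c = b - scaleM c a" for c
  have f_apply [simp]: "f c v = b v - c * a v" for c v
    by (simp add: f_def scaleM_def)
  have f_perp: "f c \<in> perp \<sigma>" for c
    unfolding f_def using ab by (intro M.subspace_diff M.subspace_scale subspace_perp)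
  then have f_MQ: "f c \<in> MQ" for c
    using perp_subset_MQ by blast
  have lower: "c\<^sub>1 * a v \<le> b v" if "v \<in> \<gamma>" for v
  proof -
    have "0 \<le> f c\<^sub>1 t" if t: "t \<in> T" for t
    proof (cases "t \<in> T'")
      case True
      then have "c\<^sub>1 \<le> b t / a t"
        using T'(1) unfolding c\<^sub>1_def slope_def by (intro Min_le) auto
      with True show ?thesis by (simp add: T'_def field_simps)
    qed (use T'(2) t in simp)
    then have "0 \<le> f c\<^sub>1 v"
      using cone_nonneg[OF f_MQ] that T(3) by blast
    then show ?thesis by simp
  qed
  have upper: "b v \<le> c\<^sub>2 * a v" if "v \<in> \<gamma>" for v
  proof -
    have "0 \<le> (- f c\<^sub>2) t" if t: "t \<in> T" for t
    proof (cases "t \<in> T'")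
      case True
      then have "b t / a t \<le> c\<^sub>2"
        using T'(1) unfolding c\<^sub>2_def slope_def by (intro Max_ge) auto
      with True show ?thesis by (simp add: T'_def field_simps)
    qed (use T'(2) t in simp)
    moreover have "- f c\<^sub>2 \<in> MQ"
      using f_MQ subspace_MQ by (intro M.subspace_neg)
    ultimately have "0 \<le> (- f c\<^sub>2) v"
      using cone_nonneg that T(3) by blast
    then show ?thesis by simp
  qed
  \<comment> \<open>Equal slopes would make \<open>b\<close> proportional to \<open>a\<close> on
    \<gamma>; the values at \<open>x\<close> force the factor 0, which contradicts
    \<open>b y = 1\<close>.\<close>
  have "c\<^sub>1 \<noteq> c\<^sub>2"
  proof
    assume "c\<^sub>1 = c\<^sub>2"
    then have eq: "b v = c\<^sub>1 * a v" if "v \<in> \<gamma>" for v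
      using lower upper that by force
    with xy have "c\<^sub>1 = 0" by force
    with eq[OF xy(4)] xy(5) show False by simp
  qed
  define \<tau> where "\<tau> c = {v \<in> \<gamma>. b v = c * a v}" for c
  \<comment> \<open>\<open>s\<close> shows that \<sigma> has smaller dimension than the face, and
    \<open>t\<close> that the face has smaller dimension than \<gamma>. Two strict increases adding
    up to 2 are both equal to 1.\<close>
  have facets: "\<tau> c \<in> \<Sigma> \<and> facet \<sigma> (\<tau> c) \<and> facet (\<tau> c) \<gamma>"
    if face: "face (\<tau> c) \<gamma>" and s: "s \<in> \<gamma>" "0 < a s" "b s = c * a s"
      and t: "t \<in> \<gamma>" "b t \<noteq> c * a t" for c s t
  proof -
    have \<tau>\<Sigma>: "\<tau> c \<in> \<Sigma>"
      using fanD(2)[OF assms(1,3) face] .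
    have "f c v = 0" if "v \<in> \<sigma>" for v
      using f_perp that by (rule perp_eq_0)
    then have \<sigma>\<tau>: "\<sigma> \<subseteq> \<tau> c"
      using sub by (auto simp: \<tau>_def)
    have "s \<notin> span \<sigma>"
      using perp_span_eq_0[OF ab(1)] s by force
    then have "dim \<sigma> < dim (\<tau> c)"
      using s \<sigma>\<tau> by (intro dim_less_if_not_in_span[of _ _ s]) (auto simp: \<tau>_def)
    moreover have "f c \<in> perp (\<tau> c)"
      using f_MQ by (auto simp: perp_def \<tau>_def)
    then have "t \<notin> span (\<tau> c)"
      using perp_span_eq_0[of "f c" "\<tau> c" t] t by auto
    then have "dim (\<tau> c) < dim \<gamma>"
      using t by (intro dim_less_if_not_in_span[of _ _ t]) (auto simp: \<tau>_def)
    ultimately have "dim (\<tau> c) = dim \<sigma> + 1" "dim \<gamma> = dim (\<tau> c) + 1"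
      using assms(5) by linarith+
    with \<tau>\<Sigma> face fanD(3)[OF assms(1) \<tau>\<Sigma> assms(2) \<sigma>\<tau>] show ?thesis
      by (simp add: facet_def)
  qed
  have face\<^sub>1: "face (\<tau> c\<^sub>1) \<gamma>"
    unfolding face_def \<tau>_def using f_MQ lower by (intro bexI[of _ "f c\<^sub>1"]) auto
  have face\<^sub>2: "face (\<tau> c\<^sub>2) \<gamma>"
    unfolding face_def \<tau>_def using f_MQ upper
    by (intro bexI[of _ "- f c\<^sub>2"] M.subspace_neg[OF subspace_MQ]) auto
  have "\<tau>' \<in> {\<tau> c\<^sub>1, \<tau> c\<^sub>2}" if f: "facet \<sigma> \<tau>'" "facet \<tau>' \<gamma>" for \<tau>'
  proof -
    obtain m where m: "m \<in> MQ" "\<And>v. v \<in> \<gamma> \<Longrightarrow> 0 \<le> m v" "\<tau>' = {v \<in> \<gamma>. m v = 0}"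
      using f(2) by (auto simp: facet_def face_def)
    have sub': "\<sigma> \<subseteq> \<tau>'" "\<sigma> \<noteq> \<tau>'" "\<tau>' \<noteq> \<gamma>"
      using f by (auto simp: facet_def dest: face_subset)
    then have "m \<in> perp \<sigma>"
      using m(1,3) by (auto simp: perp_def)
    then obtain \<alpha> \<beta> where rep_m: "\<And>v. v \<in> \<gamma> \<Longrightarrow> m v = \<alpha> * a v + \<beta> * b v"
      using rep by blast
    obtain w where w: "w \<in> \<tau>'" "w \<notin> \<sigma>"
      using sub' by blast
    then have aw: "w \<in> \<gamma>" "0 < a w" "\<alpha> * a w + \<beta> * b w = 0"
      using m(3) ab(2,3)[of w] rep_m[of w] by auto
    \<comment> \<open>Otherwise \<open>m\<close> is a multiple of \<open>a\<close> that vanishes at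
      \<open>w\<close>, where \<open>a\<close> is positive; then \<open>m\<close> is 0 on \<gamma>
      and the face is not proper.\<close>
    have "\<beta> \<noteq> 0"
    proof
      assume "\<beta> = 0"
      with aw have "\<alpha> = 0" by simp
      with \<open>\<beta> = 0\<close> have "\<tau>' = \<gamma>"
        using rep_m m(3) by auto
      with sub'(3) show False by blast
    qed
    define c where "c = b w / a w"
    have bw: "b w = c * a w"
      using aw(2) by (simp add: c_def)
    have "(\<alpha> + \<beta> * c) * a w = \<alpha> * a w + \<beta> * b w"
      by (simp only: bw distrib_right mult.assoc)
    also have "\<dots> = 0" by (rule aw(3))
    finally have "\<alpha> + \<beta> * c = 0"
      using aw(2) by simp
    then have "\<alpha> = - (\<beta> * c)"
      by (rule eq_neg_iff_add_eq_0[THEN iffD2])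
    then have m_eq: "m v = \<beta> * (b v - c * a v)" if "v \<in> \<gamma>" for v
      unfolding rep_m[OF that] by (simp add: right_diff_distrib)
    then have \<tau>': "\<tau>' = \<tau> c"
      using m(3) \<open>\<beta> \<noteq> 0\<close> by (auto simp: \<tau>_def)
    have ineq: "c\<^sub>1 \<le> c" "c \<le> c\<^sub>2"
      using lower[OF aw(1)] upper[OF aw(1)] bw aw(2) by auto
    show ?thesis
    \<comment> \<open>The sign of \<beta> decides which extreme generator is tested: nonnegativity
      of \<open>m\<close> at \<open>s\<^sub>1\<close> gives \<open>c \<le> c\<^sub>1\<close>, and at
      \<open>s\<^sub>2\<close> it gives \<open>c\<^sub>2 \<le> c\<close>.\<close>
    proof (cases "\<beta> > 0")
      case True
      with m(2)[OF s(1)] m_eq[OF s(1)] have "c * a s\<^sub>1 \<le> b s\<^sub>1"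
        by (simp add: zero_le_mult_iff)
      with s ineq have "c = c\<^sub>1" by simp
      with \<tau>' show ?thesis by simp
    next
      case False
      with \<open>\<beta> \<noteq> 0\<close> m(2)[OF s(4)] m_eq[OF s(4)] have "b s\<^sub>2 \<le> c * a s\<^sub>2"
        by (simp add: zero_le_mult_iff)
      with s ineq have "c = c\<^sub>2" by simp
      with \<tau>' show ?thesis by simp
    qed
  qed
  moreover have "\<tau> c\<^sub>1 \<in> \<Sigma> \<and> facet \<sigma> (\<tau> c\<^sub>1) \<and> facet (\<tau> c\<^sub>1) \<gamma>"
    using s \<open>c\<^sub>1 \<noteq> c\<^sub>2\<close> by (intro facets[OF face\<^sub>1 s(1-3) s(4)]) auto
  moreover have "\<tau> c\<^sub>2 \<in> \<Sigma> \<and> facet \<sigma> (\<tau> c\<^sub>2) \<and> facet (\<tau> c\<^sub>2) \<gamma>"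
    using s \<open>c\<^sub>1 \<noteq> c\<^sub>2\<close> by (intro facets[OF face\<^sub>2 s(4-6) s(1)]) auto
  ultimately have "{\<tau>' \<in> \<Sigma>. facet \<sigma> \<tau>' \<and> facet \<tau>' \<gamma>} = {\<tau> c\<^sub>1, \<tau> c\<^sub>2}"
    by blast
  moreover have "\<tau> c\<^sub>1 \<noteq> \<tau> c\<^sub>2"
  proof
    assume "\<tau> c\<^sub>1 = \<tau> c\<^sub>2"
    moreover have "s\<^sub>1 \<in> \<tau> c\<^sub>1"
      using s by (simp add: \<tau>_def)
    ultimately have "s\<^sub>1 \<in> \<tau> c\<^sub>2" by simp
    with s \<open>c\<^sub>1 \<noteq> c\<^sub>2\<close> show False by (simp add: \<tau>_def)
  qed
  ultimately show thesis
    using ab lower upper by (intro that[of a c\<^sub>1 b c\<^sub>2 "\<tau> c\<^sub>1" "\<tau> c\<^sub>2"]) (auto simp: \<tau>_def)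
qed

section \<open>Determinants and changes of lattice basis\<close>

definition det2 :: "('v \<Rightarrow> rat) \<Rightarrow> ('v \<Rightarrow> rat) \<Rightarrow> 'v \<Rightarrow> 'v \<Rightarrow> rat" where
  "det2 f g x y = f x * g y - g x * f y"

text \<open>
  The integer \<open>k\<close> is the determinant of the coordinates of \<open>x'\<close> and \<open>y'\<close> in the basis \<open>(x, y)\<close> of
  \<open>N\<^sub>\<gamma> / N\<^sub>\<sigma>\<close>.
\<close>

lemma det2_base_change:
  assumes "\<And>v. v \<in> N_cone \<tau> \<Longrightarrow> \<exists>k::int. v - of_int k *s x \<in> N_cone \<sigma>"
    and "\<And>v. v \<in> N_cone \<gamma> \<Longrightarrow> \<exists>k::int. v - of_int k *s y \<in> N_cone \<tau>"
    and "x' \<in> N_cone \<gamma>" "y' \<in> N_cone \<gamma>"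
  obtains k :: int where "\<And>f g. f \<in> perp \<sigma> \<Longrightarrow> g \<in> perp \<sigma> \<Longrightarrow> det2 f g x' y' = of_int k * det2 f g x y"
proof -
  \<comment> \<open>Reduce \<open>v\<close> by a multiple of \<open>y\<close> into
    \<open>N_cone \<tau>\<close>, then by a multiple of \<open>x\<close> into
    \<open>N_cone \<sigma>\<close>; functionals in M(\<sigma>) do not see the remainder.\<close>
  have coords: "\<exists>p q :: int. \<forall>f\<in>perp \<sigma>. f v = of_int p * f x + of_int q * f y" if v: "v \<in> N_cone \<gamma>" for v
  proof -
    obtain q :: int where "v - of_int q *s y \<in> N_cone \<tau>"
      using assms(2)[OF v] by blast
    then obtain p :: int where p: "v - of_int q *s y - of_int p *s x \<in> span \<sigma>"
      using assms(1) N_cone_subset_span by blast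
    have "f v = of_int p * f x + of_int q * f y" if f: "f \<in> perp \<sigma>" for f
    proof -
      have "f \<in> MQ"
        using f perp_subset_MQ by blast
      with perp_span_eq_0[OF f p] show ?thesis
        by (simp add: MQ_diff MQ_scale)
    qed
    then show ?thesis by blast
  qed
  obtain p q :: int where x': "\<forall>f\<in>perp \<sigma>. f x' = of_int p * f x + of_int q * f y"
    using coords[OF assms(3)] by blast
  obtain r s :: int where y': "\<forall>f\<in>perp \<sigma>. f y' = of_int r * f x + of_int s * f y"
    using coords[OF assms(4)] by blast
  show thesis
  proof (rule that[of "p * s - q * r"])
    fix f g assume f: "f \<in> perp \<sigma>" and g: "g \<in> perp \<sigma>"
    note eqs = bspec[OF x' f] bspec[OF x' g] bspec[OF y' f] bspec[OF y' g]
    show "det2 f g x' y' = of_int (p * s - q * r) * det2 f g x y"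
      unfolding det2_def eqs by (simp add: algebra_simps)
  qed
qed

text \<open>The integers \<open>k\<close> and \<open>l\<close> are determinants of mutually inverse
  base changes, so their product is 1. The opposite signs on the test pair \<open>a\<close>,
  \<open>b\<close> leave only \<open>k = - 1\<close>, and the same \<open>k\<close> serves every
  pair \<open>f\<close>, \<open>g\<close>.\<close>

lemma opposite_bases:
  assumes "\<And>f g. f \<in> perp \<sigma> \<Longrightarrow> g \<in> perp \<sigma> \<Longrightarrow> det2 f g x' y' = of_int k * det2 f g x y"
    and "\<And>f g. f \<in> perp \<sigma> \<Longrightarrow> g \<in> perp \<sigma> \<Longrightarrow> det2 f g x y = of_int l * det2 f g x' y'"
    and "a \<in> perp \<sigma>" "b \<in> perp \<sigma>" "det2 a b x y > 0" "det2 a b x' y' < 0"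
    and "f \<in> perp \<sigma>" "g \<in> perp \<sigma>"
  shows "det2 f g x y + det2 f g x' y' = 0"
proof -
  have ab: "det2 a b x' y' = of_int k * det2 a b x y" "det2 a b x y = of_int l * det2 a b x' y'"
    using assms(1-4) by blast+
  have "det2 a b x y = of_int (l * k) * det2 a b x y"
    by (simp only: of_int_mult mult.assoc flip: ab)
  with assms(5) have "of_int (l * k) = (1 :: rat)" by simp
  then have "k * l = 1"
    by (simp only: of_int_eq_1_iff mult.commute)
  moreover have "k < 0"
    using ab(1) assms(5,6) by (auto simp: mult_less_0_iff)
  ultimately have "k = - 1"
    using zmult_eq_1_iff[of k l] by auto
  with assms(1)[OF assms(7,8)] show ?thesis by simp
qed

subsection \<open>Commutativity\<close>

definition coeff :: "('v set \<Rightarrow> ('v \<Rightarrow> rat) set) \<Rightarrow> ('v set \<Rightarrow> ('v \<Rightarrow> rat) set) \<Rightarrow> 'v set \<Rightarrow> 'v set \<Rightarrow> rat" where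
  "coeff \<Psi> D \<sigma> \<tau> = pairing (proj \<Psi> \<sigma> ` D \<tau>) (normal_gen \<tau> \<sigma>)"

lemma lookup_act_cone:
  assumes "finite \<Sigma>"
  shows "Poly_Mapping.lookup (act_cone \<Sigma> \<Psi> D \<sigma>) \<tau> =
    (if \<tau> \<in> \<Sigma> \<and> facet \<sigma> \<tau> then coeff \<Psi> D \<sigma> \<tau> else 0)"
proof -
  have "Poly_Mapping.lookup (act_cone \<Sigma> \<Psi> D \<sigma>) \<tau> =
      (\<Sum>\<rho>\<in>{\<rho> \<in> \<Sigma>. facet \<sigma> \<rho>}. if \<rho> = \<tau> then coeff \<Psi> D \<sigma> \<rho> else 0)"
    unfolding act_cone_def lookup_sum coeff_def
    by (intro sum.cong) (auto simp: V_def lookup_single when_def)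
  also have "\<dots> = (if \<tau> \<in> \<Sigma> \<and> facet \<sigma> \<tau> then coeff \<Psi> D \<sigma> \<tau> else 0)"
    using assms by simp
  finally show ?thesis .
qed

lemma lookup_act_act_cone:
  assumes "finite \<Sigma>"
  shows "Poly_Mapping.lookup (act \<Sigma> \<Psi> D (act_cone \<Sigma> \<Psi> E \<sigma>)) \<gamma> =
    (if \<gamma> \<in> \<Sigma> then \<Sum>\<tau> | \<tau> \<in> \<Sigma> \<and> facet \<sigma> \<tau> \<and> facet \<tau> \<gamma>. coeff \<Psi> E \<sigma> \<tau> * coeff \<Psi> D \<tau> \<gamma> else 0)"
proof -
  let ?z = "act_cone \<Sigma> \<Psi> E \<sigma>"
  let ?F = "\<lambda>\<tau>. Poly_Mapping.lookup ?z \<tau> * Poly_Mapping.lookup (act_cone \<Sigma> \<Psi> D \<tau>) \<gamma>"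
  have "Poly_Mapping.lookup (act \<Sigma> \<Psi> D ?z) \<gamma> = sum ?F (Poly_Mapping.keys ?z)"
    by (simp add: act_def lookup_sum)
  \<comment> \<open>The support of a cycle depends on the divisor; summing over all of \<Sigma>
    removes this dependence, as the added terms are 0.\<close>
  also have "\<dots> = sum ?F \<Sigma>"
    using assms
    by (intro sum.mono_neutral_left) (auto simp: in_keys_iff lookup_act_cone split: if_splits)
  also have "\<dots> = (\<Sum>\<tau>\<in>\<Sigma>. if facet \<sigma> \<tau> \<and> facet \<tau> \<gamma> \<and> \<gamma> \<in> \<Sigma> then coeff \<Psi> E \<sigma> \<tau> * coeff \<Psi> D \<tau> \<gamma> else 0)"
    using assms by (intro sum.cong) (auto simp: lookup_act_cone)
  also have "\<dots> = (if \<gamma> \<in> \<Sigma> then \<Sum>\<tau> | \<tau> \<in> \<Sigma> \<and> facet \<sigma> \<tau> \<and> facet \<tau> \<gamma>. coeff \<Psi> E \<sigma> \<tau> * coeff \<Psi> D \<tau> \<gamma> else 0)"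
    using assms by (simp add: sum.inter_filter)
  finally show ?thesis .
qed

text \<open>
  The component of \<open>d \<in> M(\<sigma>)\<close> in \<open>\<Psi> \<tau> \<inter> M(\<sigma>)\<close> is determined by \<open>d(x)\<close>, because this space is
  one-dimensional; its contribution is therefore symmetric in \<open>d\<close> and \<open>e\<close> and cancels.
\<close>

lemma antisymmetrized_proj:
  assumes "complements \<Sigma> \<Psi>" "\<tau> \<in> \<Sigma>" "facet \<sigma> \<tau>" "x \<in> \<tau>" "x \<notin> span \<sigma>"
    and "d \<in> perp \<sigma>" "e \<in> perp \<sigma>"
  shows "e x * proj \<Psi> \<tau> d y - d x * proj \<Psi> \<tau> e y = det2 e d x y"
proof -
  have sub: "\<sigma> \<subseteq> \<tau>" and dim: "dim \<tau> = dim \<sigma> + 1"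
    using assms(3) by (auto simp: facet_def face_subset)
  have MQ: "d \<in> MQ" "e \<in> MQ"
    using assms(6,7) perp_subset_MQ by blast+
  define r where "r m = m - proj \<Psi> \<tau> m" for m
  have r: "r m \<in> \<Psi> \<tau>" "r m \<in> perp \<sigma>" "r m x = m x" if m: "m \<in> perp \<sigma>" for m
  proof -
    have m': "m \<in> MQ"
      using m perp_subset_MQ by blast
    have p: "proj \<Psi> \<tau> m \<in> perp \<tau>"
      using proj_in_perp[OF assms(1,2) m'] .
    show "r m \<in> \<Psi> \<tau>"
      unfolding r_def by (rule diff_proj_in_complement[OF assms(1,2) m'])
    show "r m \<in> perp \<sigma>"
      unfolding r_def using m p perp_antimono[OF sub] by (intro M.subspace_diff subspace_perp) auto
    show "r m x = m x"
      using perp_eq_0[OF p assms(4)] by (simp add: r_def)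
  qed
  \<comment> \<open>This combination of the components in \<open>\<Psi> \<tau>\<close> is made to
    vanish at \<open>x\<close>. It vanishes on \<sigma> too, hence on \<tau>, so it lies in both
    M(\<tau>) and \<open>\<Psi> \<tau>\<close> and is 0.\<close>
  define h where "h = scaleM (e x) (r d) - scaleM (d x) (r e)"
  have h\<Psi>: "h \<in> \<Psi> \<tau>"
    unfolding h_def using r assms(6,7) complementsD(2)[OF assms(1,2)]
    by (intro M.subspace_diff M.subspace_scale) auto
  have "h \<in> perp \<sigma>"
    unfolding h_def using r assms(6,7) by (intro M.subspace_diff M.subspace_scale subspace_perp) auto
  moreover have "h x = 0"
    using r assms(6,7) by (simp add: h_def scaleM_def)
  ultimately have "h \<in> perp (insert x \<sigma>)"
    by (auto simp: perp_def)
  moreover have "span (insert x \<sigma>) = span \<tau>"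
    using sub dim assms(4,5) by (intro span_insert_eq_span)
  ultimately have "h \<in> perp \<tau>"
    using perp_subset_MQ span_superset[of \<tau>] perp_eq_0
    by (intro perp_spanI[of h "insert x \<sigma>"]) auto
  with h\<Psi> complementsD(4)[OF assms(1,2)] have "h = 0" by blast
  then have "h y = 0" by simp
  then show ?thesis
    by (simp add: h_def r_def scaleM_def det2_def algebra_simps)
qed

text \<open>By compatibility, a representative of the local equation on \<gamma> represents it on
  every face of \<gamma> as well, so one functional serves all intermediate cones.\<close>

lemma Q_Cartier_divisorD:
  assumes "Q_Cartier_divisor \<Sigma> D" "\<gamma> \<in> \<Sigma>"
  obtains d where "d \<in> MQ" "d \<in> D \<gamma>" "\<And>\<tau>. \<tau> \<in> \<Sigma> \<Longrightarrow> proper_face \<tau> \<gamma> \<Longrightarrow> d \<in> D \<tau>"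
proof -
  obtain d where d: "d \<in> MQ" "D \<gamma> = d +o perp \<gamma>"
    using assms unfolding Q_Cartier_divisor_def M_cone_def cosets_def by blast
  have zero: "0 \<in> perp A" for A
    using subspace_perp by (rule M.subspace_0)
  have "d + 0 \<in> D \<gamma>"
    unfolding d(2) using zero by (rule set_plus_intro2)
  moreover have "d \<in> D \<tau>" if "\<tau> \<in> \<Sigma>" "proper_face \<tau> \<gamma>" for \<tau>
  proof -
    have "D \<tau> = D \<gamma> + perp \<tau>"
      using assms that unfolding Q_Cartier_divisor_def by metis
    with set_plus_intro[OF \<open>d + 0 \<in> D \<gamma>\<close> zero[of \<tau>]] show ?thesis by simp
  qed
  ultimately show thesis
    using d(1) that by auto
qed

lemma coeff_products_commute:
  assumes "fan \<Sigma>" "complements \<Sigma> \<Psi>" "Q_Cartier_divisor \<Sigma> D" "Q_Cartier_divisor \<Sigma> E"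
    and "\<sigma> \<in> \<Sigma>" "\<gamma> \<in> \<Sigma>"
  shows "(\<Sum>\<tau> | \<tau> \<in> \<Sigma> \<and> facet \<sigma> \<tau> \<and> facet \<tau> \<gamma>. coeff \<Psi> E \<sigma> \<tau> * coeff \<Psi> D \<tau> \<gamma>) =
    (\<Sum>\<tau> | \<tau> \<in> \<Sigma> \<and> facet \<sigma> \<tau> \<and> facet \<tau> \<gamma>. coeff \<Psi> D \<sigma> \<tau> * coeff \<Psi> E \<tau> \<gamma>)"
proof (cases "{\<tau> \<in> \<Sigma>. facet \<sigma> \<tau> \<and> facet \<tau> \<gamma>} = {}")
  case True
  then show ?thesis by (simp only: sum.empty)
next
  case False
  \<comment> \<open>A single intermediate cone fixes the relative dimension at 2, which is what
    \<open>diamond\<close> needs.\<close>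
  then have "\<sigma> \<subseteq> \<gamma>" and dim: "dim \<gamma> = dim \<sigma> + 2"
    by (force simp: facet_def dest: face_subset)+
  then have face: "face \<sigma> \<gamma>"
    using fanD(3)[OF assms(1)] assms(5,6) by blast
  obtain a b c\<^sub>1 c\<^sub>2 \<tau>\<^sub>1 \<tau>\<^sub>2 where
    bounds: "\<forall>v\<in>\<gamma>. 0 \<le> a v \<and> (a v = 0 \<longleftrightarrow> v \<in> \<sigma>) \<and> c\<^sub>1 * a v \<le> b v \<and> b v \<le> c\<^sub>2 * a v"
    and ab: "a \<in> perp \<sigma>" "b \<in> perp \<sigma>"
    and \<tau>: "\<tau>\<^sub>1 \<noteq> \<tau>\<^sub>2" "\<tau>\<^sub>1 = {v \<in> \<gamma>. b v = c\<^sub>1 * a v}" "\<tau>\<^sub>2 = {v \<in> \<gamma>. b v = c\<^sub>2 * a v}"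
    and facets: "{\<tau> \<in> \<Sigma>. facet \<sigma> \<tau> \<and> facet \<tau> \<gamma>} = {\<tau>\<^sub>1, \<tau>\<^sub>2}"
    by (rule diamond[OF assms(1,5,6) face dim]) (rule that, assumption+)
  have f\<^sub>1: "\<tau>\<^sub>1 \<in> \<Sigma>" "facet \<sigma> \<tau>\<^sub>1" "facet \<tau>\<^sub>1 \<gamma>" and f\<^sub>2: "\<tau>\<^sub>2 \<in> \<Sigma>" "facet \<sigma> \<tau>\<^sub>2" "facet \<tau>\<^sub>2 \<gamma>"
    using facets by blast+
  obtain d where d: "d \<in> MQ" "d \<in> D \<gamma>" "\<And>\<tau>. \<tau> \<in> \<Sigma> \<Longrightarrow> proper_face \<tau> \<gamma> \<Longrightarrow> d \<in> D \<tau>"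
    using Q_Cartier_divisorD[OF assms(3,6)] by blast
  obtain e where e: "e \<in> MQ" "e \<in> E \<gamma>" "\<And>\<tau>. \<tau> \<in> \<Sigma> \<Longrightarrow> proper_face \<tau> \<gamma> \<Longrightarrow> e \<in> E \<tau>"
    using Q_Cartier_divisorD[OF assms(4,6)] by blast
  define d' where "d' = proj \<Psi> \<sigma> d"
  define e' where "e' = proj \<Psi> \<sigma> e"
  have perp: "d' \<in> perp \<sigma>" "e' \<in> perp \<sigma>"
    unfolding d'_def e'_def using proj_in_perp[OF assms(2,5)] d(1) e(1) by blast+
  note cones = fanD(1)[OF assms(1)]
  \<comment> \<open>For each intermediate cone, the difference of its two summands is a determinant
    in lattice points that generate the two successive quotients.\<close>
  have step: "\<exists>x y. x \<in> \<tau> \<and> y \<in> \<gamma> \<and> x \<in> N \<and> y \<in> N \<and> x \<notin> span \<sigma> \<and> y \<notin> span \<tau>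
      \<and> (\<forall>v\<in>N_cone \<tau>. \<exists>k::int. v - of_int k *s x \<in> N_cone \<sigma>)
      \<and> (\<forall>v\<in>N_cone \<gamma>. \<exists>k::int. v - of_int k *s y \<in> N_cone \<tau>)
      \<and> coeff \<Psi> E \<sigma> \<tau> * coeff \<Psi> D \<tau> \<gamma> - coeff \<Psi> D \<sigma> \<tau> * coeff \<Psi> E \<tau> \<gamma> = det2 e' d' x y"
    if \<tau>: "\<tau> \<in> \<Sigma>" "facet \<sigma> \<tau>" "facet \<tau> \<gamma>" for \<tau>
  proof -
    obtain x where x: "x \<in> \<tau>" "x \<in> N" "x \<notin> span \<sigma>" "normal_gen \<tau> \<sigma> = x +o N_cone \<sigma>"
      "\<And>v. v \<in> N_cone \<tau> \<Longrightarrow> \<exists>k::int. v - of_int k *s x \<in> N_cone \<sigma>"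
      using normal_gen[OF cones[OF assms(5)] cones[OF \<tau>(1)] \<tau>(2)] by blast
    obtain y where y: "y \<in> \<gamma>" "y \<in> N" "y \<notin> span \<tau>" "normal_gen \<gamma> \<tau> = y +o N_cone \<tau>"
      "\<And>v. v \<in> N_cone \<gamma> \<Longrightarrow> \<exists>k::int. v - of_int k *s y \<in> N_cone \<tau>"
      using normal_gen[OF cones[OF \<tau>(1)] cones[OF assms(6)] \<tau>(3)] by blast
    have sub: "\<sigma> \<subseteq> \<tau>" "\<tau> \<subseteq> \<gamma>"
      using \<tau> by (auto simp: facet_def dest: face_subset)
    have proper: "proper_face \<sigma> \<tau>" "proper_face \<tau> \<gamma>"
      using \<tau> facet_imp_proper_face by blast+
    have "coeff \<Psi> E \<sigma> \<tau> = e' x" "coeff \<Psi> D \<sigma> \<tau> = d' x"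
      unfolding coeff_def x(4) d'_def e'_def
      using pairing_proj[OF assms(2) _ assms(5) \<tau>(1) sub(1) _ x(1)] assms(3,4) d(3) e(3) \<tau>(1) proper(2)
      by blast+
    \<comment> \<open>By \<open>proj_proj\<close>, replacing \<open>d\<close> and \<open>e\<close>
      by their projections to M(\<sigma>) changes nothing here, so both factors of each summand come
      from the same two functionals \<open>d'\<close> and \<open>e'\<close>.\<close>
    moreover have "coeff \<Psi> E \<tau> \<gamma> = proj \<Psi> \<tau> e' y" "coeff \<Psi> D \<tau> \<gamma> = proj \<Psi> \<tau> d' y"
      unfolding coeff_def y(4) d'_def e'_def
        proj_proj[OF assms(2,5) \<tau>(1) proper(1) d(1)] proj_proj[OF assms(2,5) \<tau>(1) proper(1) e(1)]
      using pairing_proj[OF assms(2) _ \<tau>(1) assms(6) sub(2) _ y(1)] assms(3,4) d(2) e(2)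
      by blast+
    ultimately show ?thesis
      using x y antisymmetrized_proj[OF assms(2) \<tau>(1,2) x(1,3) perp, of y] by metis
  qed
  obtain x\<^sub>1 y\<^sub>1 where 1: "x\<^sub>1 \<in> \<tau>\<^sub>1" "y\<^sub>1 \<in> \<gamma>" "x\<^sub>1 \<in> N" "y\<^sub>1 \<in> N" "x\<^sub>1 \<notin> span \<sigma>" "y\<^sub>1 \<notin> span \<tau>\<^sub>1"
      "\<And>v. v \<in> N_cone \<tau>\<^sub>1 \<Longrightarrow> \<exists>k::int. v - of_int k *s x\<^sub>1 \<in> N_cone \<sigma>"
      "\<And>v. v \<in> N_cone \<gamma> \<Longrightarrow> \<exists>k::int. v - of_int k *s y\<^sub>1 \<in> N_cone \<tau>\<^sub>1"
      "coeff \<Psi> E \<sigma> \<tau>\<^sub>1 * coeff \<Psi> D \<tau>\<^sub>1 \<gamma> - coeff \<Psi> D \<sigma> \<tau>\<^sub>1 * coeff \<Psi> E \<tau>\<^sub>1 \<gamma> = det2 e' d' x\<^sub>1 y\<^sub>1"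
    using step[OF f\<^sub>1] by blast
  obtain x\<^sub>2 y\<^sub>2 where 2: "x\<^sub>2 \<in> \<tau>\<^sub>2" "y\<^sub>2 \<in> \<gamma>" "x\<^sub>2 \<in> N" "y\<^sub>2 \<in> N" "x\<^sub>2 \<notin> span \<sigma>" "y\<^sub>2 \<notin> span \<tau>\<^sub>2"
      "\<And>v. v \<in> N_cone \<tau>\<^sub>2 \<Longrightarrow> \<exists>k::int. v - of_int k *s x\<^sub>2 \<in> N_cone \<sigma>"
      "\<And>v. v \<in> N_cone \<gamma> \<Longrightarrow> \<exists>k::int. v - of_int k *s y\<^sub>2 \<in> N_cone \<tau>\<^sub>2"
      "coeff \<Psi> E \<sigma> \<tau>\<^sub>2 * coeff \<Psi> D \<tau>\<^sub>2 \<gamma> - coeff \<Psi> D \<sigma> \<tau>\<^sub>2 * coeff \<Psi> E \<tau>\<^sub>2 \<gamma> = det2 e' d' x\<^sub>2 y\<^sub>2"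
    using step[OF f\<^sub>2] by blast
  have sub: "\<tau>\<^sub>1 \<subseteq> \<gamma>" "\<tau>\<^sub>2 \<subseteq> \<gamma>"
    using \<tau> by blast+
  have N\<gamma>: "x\<^sub>1 \<in> N_cone \<gamma>" "y\<^sub>1 \<in> N_cone \<gamma>" "x\<^sub>2 \<in> N_cone \<gamma>" "y\<^sub>2 \<in> N_cone \<gamma>"
    using 1 2 sub by (auto intro: N_cone_base)
  obtain k :: int where k: "\<And>f g. f \<in> perp \<sigma> \<Longrightarrow> g \<in> perp \<sigma> \<Longrightarrow> det2 f g x\<^sub>2 y\<^sub>2 = of_int k * det2 f g x\<^sub>1 y\<^sub>1"
    using det2_base_change[OF 1(7,8) N\<gamma>(3,4)] by blast
  obtain l :: int where l: "\<And>f g. f \<in> perp \<sigma> \<Longrightarrow> g \<in> perp \<sigma> \<Longrightarrow> det2 f g x\<^sub>1 y\<^sub>1 = of_int l * det2 f g x\<^sub>2 y\<^sub>2"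
    using det2_base_change[OF 2(7,8) N\<gamma>(1,2)] by blast
  have axy: "0 < a x\<^sub>1" "0 < a x\<^sub>2"
    using bspec[OF bounds, of x\<^sub>1] bspec[OF bounds, of x\<^sub>2] 1(1,5) 2(1,5) sub
      span_base[of x\<^sub>1 \<sigma>] span_base[of x\<^sub>2 \<sigma>]
    by (auto simp: order_le_less)
  \<comment> \<open>The bound is strict because \<open>y\<^sub>1\<close> lies outside
    \<open>\<tau>\<^sub>1\<close>. On \<open>\<tau>\<^sub>1\<close> the value of \<open>b\<close> is
    \<open>c\<^sub>1\<close> times that of \<open>a\<close>, so the determinant factors and its sign
    can be read off; at the upper slope the sign is reversed.\<close>
  have "c\<^sub>1 * a y\<^sub>1 < b y\<^sub>1"
    using bspec[OF bounds, of y\<^sub>1] 1(2,6) \<tau>(2) span_base[of y\<^sub>1 \<tau>\<^sub>1] by (auto simp: order_le_less)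
  moreover have "det2 a b x\<^sub>1 y\<^sub>1 = a x\<^sub>1 * (b y\<^sub>1 - c\<^sub>1 * a y\<^sub>1)"
    using 1(1) \<tau>(2) by (simp add: det2_def algebra_simps)
  ultimately have pos: "det2 a b x\<^sub>1 y\<^sub>1 > 0"
    using axy by simp
  have "b y\<^sub>2 < c\<^sub>2 * a y\<^sub>2"
    using bspec[OF bounds, of y\<^sub>2] 2(2,6) \<tau>(3) span_base[of y\<^sub>2 \<tau>\<^sub>2] by (auto simp: order_le_less)
  moreover have "det2 a b x\<^sub>2 y\<^sub>2 = a x\<^sub>2 * (b y\<^sub>2 - c\<^sub>2 * a y\<^sub>2)"
    using 2(1) \<tau>(3) by (simp add: det2_def algebra_simps)
  ultimately have neg: "det2 a b x\<^sub>2 y\<^sub>2 < 0"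
    using axy by (simp add: mult_pos_neg)
  have "det2 e' d' x\<^sub>1 y\<^sub>1 + det2 e' d' x\<^sub>2 y\<^sub>2 = 0"
    using opposite_bases[OF k l ab(1,2) pos neg perp(2,1)] by blast
  with 1(9) 2(9) show ?thesis
    unfolding facets using \<tau>(1) by simp
qed

lemma act_commute:
  assumes "fan \<Sigma>" "complements \<Sigma> \<Psi>" "Q_Cartier_divisor \<Sigma> D" "Q_Cartier_divisor \<Sigma> E" "\<sigma> \<in> \<Sigma>"
  shows "act \<Sigma> \<Psi> D (act \<Sigma> \<Psi> E (V \<sigma>)) = act \<Sigma> \<Psi> E (act \<Sigma> \<Psi> D (V \<sigma>))"
proof (rule poly_mapping_eqI)
  fix \<gamma>
  show "Poly_Mapping.lookup (act \<Sigma> \<Psi> D (act \<Sigma> \<Psi> E (V \<sigma>))) \<gamma> =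
      Poly_Mapping.lookup (act \<Sigma> \<Psi> E (act \<Sigma> \<Psi> D (V \<sigma>))) \<gamma>"
    using coeff_products_commute[OF assms(1-5), of \<gamma>]
    by (simp add: act_V lookup_act_act_cone[OF fanD(4)[OF assms(1)]])
qed

end

theorem theorem6p1:
  fixes scale :: "rat \<Rightarrow> 'v::ab_group_add \<Rightarrow> 'v"
    and Basis :: "'v set"
    and \<Sigma> :: "'v set set"
    and \<Psi> D E :: "'v set \<Rightarrow> ('v \<Rightarrow> rat) set"
    and \<sigma> :: "'v set"
    and n k :: nat
  assumes "toric_lattice scale Basis"
    and "card Basis = n"
    and "toric_lattice.fan scale Basis \<Sigma>"
    and "toric_lattice.complements scale \<Sigma> \<Psi>"
    and "toric_lattice.Q_Cartier_divisor scale \<Sigma> D"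
    and "toric_lattice.Q_Cartier_divisor scale \<Sigma> E"
    and "\<sigma> \<in> \<Sigma>"
    and "k \<le> n"
    and "vector_space.dim scale \<sigma> = n - k"
  shows "toric_lattice.act scale Basis \<Sigma> \<Psi> D
           (toric_lattice.act scale Basis \<Sigma> \<Psi> E (toric_lattice.V \<sigma>)) =
         toric_lattice.act scale Basis \<Sigma> \<Psi> E
           (toric_lattice.act scale Basis \<Sigma> \<Psi> D (toric_lattice.V \<sigma>))"
  using toric_lattice.act_commute[OF assms(1,3-7)] .

end
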